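(* Let $n\geq 2$ be an integer and let $G_n$ be the metric graph of genus $n+3$ described in the context. Then $w^1_4(G_n)=1$.
   Context: **The graph $G_n$.** $G_0$ is the metric graph of genus 2 having exactly two points $v_1,v_2$ of valence 3 (all other points have valence 2), connected by three edges $e_0,e_1,e_2$ of mutually different finite lengths. For $0\leq i\leq 2$, $m_i$ is the midpoint of $e_i$. Put $q_0=m_0$. Fix a point $q_1$ in the open segment $]v_1,m_1[\subset e_1$ and a point $q_2$ in the open segment $]v_2,m_2[\subset e_2$. For $n\geq 2$ fix further general different points $q_3,\dots,q_n$ on $G_0$ (i.e. $v_1,v_2,m_0,m_1,m_2,q_1,q_2,q_3,\dots,q_n$ are pairwise distinct). $G_n$ is obtained from $G_0$ by attaching, for each $0\leq i\leq n$, a loop $\gamma_i$ (a circle of some finite positive length) at $q_i$. **Divisors.** A divisor on a metric graph $\Gamma$ is a finite formal $\mathbb{Z}$-combination of points of $\Gamma$; it is effective ($D\geq 0$) if all coefficients are $\geq 0$. A rational function is a continuous piecewise linear function $\Gamma\to\mathbb{R}$ with integer slopes and finitely many pieces. Its divisor has at each point the coefficient given by the sum of outgoing slopes (up to a global sign convention), and two divisors are linearly equivalent if they differ by the divisor of a rational function. $|D|$ is the set of effective divisors linearly equivalent to $D$. The rank $\operatorname{rk}(D)$ is $-1$ if $|D|=\emptyset$, and otherwise the largest $r\ge 0$ such that $|D-F|\ne\emptyset$ for every effective $F$ of degree $r$. A $g^r_d$ on $\Gamma$ is a complete linear system $|D|$ with $\deg D=d$ and $\operatorname{rk}(D)=r$.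 **The invariant $w^r_d$.** If $\Gamma$ has no $g^r_d$ then $w^r_d(\Gamma)=-1$. Otherwise $w^r_d(\Gamma)$ is the maximal integer $w\geq 0$ such that for each effective divisor $F$ of degree $r+w$ there exists an effective divisor $E$ of degree $d$ with $\operatorname{rk}(E)\geq r$ and $E-F\geq 0$. *)

theory Defs
  imports "HOL-Analysis.Analysis" "HOL-Library.Poly_Mapping"
begin

section \<open>Metric graphs\<close>

text \<open>
  A metric graph is presented as a gluing of vertices and segments: the edge \<open>e\<close> is the interval
  \<open>[0, len e]\<close>, whose two ends are glued to the points \<open>src e\<close> and \<open>tgt e\<close>. An end may be glued to
  any point, also to an interior point of another edge; no subdivision is needed when something
  is attached in the middle of an edge. Only finitely many points are identified, so the result is
  a metric graph, and a function on it is continuous iff its pullback to each interval is.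
\<close>

datatype ('v, 'e) point = Vertex 'v | Inner 'e real

record ('v, 'e) mgraph =
  verts :: "'v set"
  edges :: "'e set"
  len :: "'e \<Rightarrow> real"
  src :: "'e \<Rightarrow> ('v, 'e) point"
  tgt :: "'e \<Rightarrow> ('v, 'e) point"

definition points :: "('v, 'e) mgraph \<Rightarrow> ('v, 'e) point set" where
  "points G = Vertex ` verts G \<union> {Inner e t | e t. e \<in> edges G \<and> 0 < t \<and> t < len G e}"

definition edge_map :: "('v, 'e) mgraph \<Rightarrow> 'e \<Rightarrow> real \<Rightarrow> ('v, 'e) point" where
  "edge_map G e t = (if t \<le> 0 then src G e else if t \<ge> len G e then tgt G e else Inner e t)"

definition wf_mgraph :: "('v, 'e) mgraph \<Rightarrow> bool" where
  "wf_mgraph G \<longleftrightarrow> finite (verts G) \<and> finite (edges G) \<and>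
     (\<forall>e\<in>edges G. 0 < len G e \<and> src G e \<in> points G \<and> tgt G e \<in> points G)"


section \<open>Rational functions\<close>

definition integral_pl_on :: "real \<Rightarrow> real \<Rightarrow> (real \<Rightarrow> real) \<Rightarrow> bool" where
  "integral_pl_on a b g \<longleftrightarrow> continuous_on {a..b} g \<and>
     (\<exists>S. finite S \<and>
       (\<forall>x y. a \<le> x \<and> x < y \<and> y \<le> b \<and> S \<inter> {x<..<y} = {} \<longrightarrow>
         (\<exists>m::int. \<exists>k. \<forall>t\<in>{x<..<y}. g t = of_int m * t + k)))"

definition rational_function :: "('v, 'e) mgraph \<Rightarrow> (('v, 'e) point \<Rightarrow> real) \<Rightarrow> bool" where
  "rational_function G f \<longleftrightarrow> (\<forall>e\<in>edges G. integral_pl_on 0 (len G e) (f \<circ> edge_map G e))"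

text \<open>
  The tangent directions at \<open>p\<close> are the pairs of an edge \<open>e\<close> and a parameter \<open>t\<close> with
  \<open>edge_map G e t = p\<close>, taken once in increasing direction if \<open>t < len e\<close> and once in decreasing
  direction if \<open>t > 0\<close>. The outgoing slope in decreasing direction is minus the left derivative.
\<close>

definition slope_sum :: "('v, 'e) mgraph \<Rightarrow> (('v, 'e) point \<Rightarrow> real) \<Rightarrow> ('v, 'e) point \<Rightarrow> real" where
  "slope_sum G f p =
     (\<Sum>(e, t)\<in>{(e, t). e \<in> edges G \<and> 0 \<le> t \<and> t < len G e \<and> edge_map G e t = p}.
        vector_derivative (f \<circ> edge_map G e) (at_right t))
   + (\<Sum>(e, t)\<in>{(e, t). e \<in> edges G \<and> 0 < t \<and> t \<le> len G e \<and> edge_map G e t = p}.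
        - vector_derivative (f \<circ> edge_map G e) (at_left t))"


section \<open>Divisors, linear equivalence and rank\<close>

type_synonym ('v, 'e) graph_div = "('v, 'e) point \<Rightarrow>\<^sub>0 int"

definition divisor :: "('v, 'e) mgraph \<Rightarrow> ('v, 'e) graph_div \<Rightarrow> bool" where
  "divisor G D \<longleftrightarrow> Poly_Mapping.keys D \<subseteq> points G"

definition div_degree :: "('v, 'e) graph_div \<Rightarrow> int" where
  "div_degree D = (\<Sum>p\<in>Poly_Mapping.keys D. Poly_Mapping.lookup D p)"

definition effective :: "('v, 'e) graph_div \<Rightarrow> bool" where
  "effective D \<longleftrightarrow> (\<forall>p. 0 \<le> Poly_Mapping.lookup D p)"

definition eff_divisors :: "('v, 'e) mgraph \<Rightarrow> int \<Rightarrow> ('v, 'e) graph_div set" where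
  "eff_divisors G d = {D. divisor G D \<and> effective D \<and> div_degree D = d}"

definition divisor_of :: "('v, 'e) mgraph \<Rightarrow> (('v, 'e) point \<Rightarrow> real) \<Rightarrow> ('v, 'e) graph_div \<Rightarrow> bool" where
  "divisor_of G f D \<longleftrightarrow> divisor G D \<and>
     (\<forall>p\<in>points G. of_int (Poly_Mapping.lookup D p) = slope_sum G f p)"

definition lin_equiv :: "('v, 'e) mgraph \<Rightarrow> ('v, 'e) graph_div \<Rightarrow> ('v, 'e) graph_div \<Rightarrow> bool" where
  "lin_equiv G D D' \<longleftrightarrow> (\<exists>f. rational_function G f \<and> divisor_of G f (D - D'))"

definition lin_sys :: "('v, 'e) mgraph \<Rightarrow> ('v, 'e) graph_div \<Rightarrow> ('v, 'e) graph_div set" where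
  "lin_sys G D = {E. divisor G E \<and> effective E \<and> lin_equiv G E D}"

text \<open>
  The maxima below are over bounded sets: no divisor of negative degree is equivalent to an
  effective one.
\<close>

definition div_rank :: "('v, 'e) mgraph \<Rightarrow> ('v, 'e) graph_div \<Rightarrow> int" where
  "div_rank G D = (if lin_sys G D = {} then -1
     else int (GREATEST r::nat. \<forall>F\<in>eff_divisors G (int r). lin_sys G (D - F) \<noteq> {}))"

definition has_grd :: "('v, 'e) mgraph \<Rightarrow> nat \<Rightarrow> nat \<Rightarrow> bool" where
  "has_grd G r d \<longleftrightarrow> (\<exists>D. divisor G D \<and> div_degree D = int d \<and> div_rank G D = int r)"

definition wrd :: "('v, 'e) mgraph \<Rightarrow> nat \<Rightarrow> nat \<Rightarrow> int" where
  "wrd G r d = (if \<not> has_grd G r d then -1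
     else int (GREATEST w::nat. \<forall>F\<in>eff_divisors G (int (r + w)).
       \<exists>E\<in>eff_divisors G (int d). div_rank G E \<ge> int r \<and> effective (E - F)))"


section \<open>The theta graph and the theta graph with loops\<close>

datatype vertex = V1 | V2

datatype edge = Seg nat | Loop nat

text \<open>The segments \<open>Seg 0\<close>, \<open>Seg 1\<close>, \<open>Seg 2\<close> are parametrised from \<open>V1\<close> to \<open>V2\<close>.\<close>

definition theta :: "(nat \<Rightarrow> real) \<Rightarrow> (vertex, edge) mgraph" where
  "theta l = \<lparr>verts = {V1, V2}, edges = Seg ` {0, 1, 2},
     len = (\<lambda>e. case e of Seg i \<Rightarrow> l i | Loop i \<Rightarrow> 0),
     src = (\<lambda>_. Vertex V1), tgt = (\<lambda>_. Vertex V2)\<rparr>"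

definition theta_mid :: "(nat \<Rightarrow> real) \<Rightarrow> nat \<Rightarrow> (vertex, edge) point" where
  "theta_mid l i = edge_map (theta l) (Seg i) (l i / 2)"

definition theta_loops ::
  "(nat \<Rightarrow> real) \<Rightarrow> (nat \<Rightarrow> (vertex, edge) point) \<Rightarrow> (nat \<Rightarrow> real) \<Rightarrow> nat \<Rightarrow> (vertex, edge) mgraph" where
  "theta_loops l q c n = \<lparr>verts = {V1, V2}, edges = Seg ` {0, 1, 2} \<union> Loop ` {0..n},
     len = (\<lambda>e. case e of Seg i \<Rightarrow> l i | Loop i \<Rightarrow> c i),
     src = (\<lambda>e. case e of Seg i \<Rightarrow> Vertex V1 | Loop i \<Rightarrow> q i),
     tgt = (\<lambda>e. case e of Seg i \<Rightarrow> Vertex V2 | Loop i \<Rightarrow> q i)\<rparr>"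

lemma points_theta_subset: "points (theta l) \<subseteq> points (theta_loops l q c n)"
  by (auto simp: points_def theta_def theta_loops_def)

lemma wf_mgraph_theta_loops:
  assumes "\<And>i. i \<le> 2 \<Longrightarrow> 0 < l i" and "\<And>i. i \<le> n \<Longrightarrow> q i \<in> points (theta l)"
    and "\<And>i. i \<le> n \<Longrightarrow> 0 < c i"
  shows "wf_mgraph (theta_loops l q c n)"
proof -
  have "q i \<in> points (theta_loops l q c n)" if "i \<le> n" for i
    using assms(2)[OF that] points_theta_subset by blast
  moreover have "Vertex v \<in> points (theta_loops l q c n)" for v
    by (cases v) (auto simp: points_def theta_loops_def)
  ultimately show ?thesis
    using assms(1,3) by (auto simp: wf_mgraph_def theta_loops_def)
qed

end

theory Submission
  imports Defs
begin

text \<open>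
  Linear equivalence on the graph is governed by finitely many numbers. Contracting every loop \<open>j\<close>
  to \<open>q j\<close> maps \<open>G\<close> onto the theta graph, and \<open>D\<close>, \<open>D'\<close> of equal degree are equivalent iff their
  images on the theta graph are, and in addition the positions of the chips inside each loop have
  the same sum modulo the length of the loop. On the theta graph the condition is that the moments
  of \<open>D - D'\<close> along the three edges become equal after adding \<open>s 0 * l 0\<close>, \<open>s 1 * l 1\<close>, \<open>s 2 * l 2\<close>
  for integers \<open>s i\<close> with sum \<open>0\<close>: the common value is the difference of the values of a rational
  function at the two vertices, and the \<open>s i\<close> come from its slopes. This tropical Abel-Jacobi criterion
  (\<open>lin_equiv_imp_invariants\<close>, \<open>invariants_imp_lin_equiv\<close>) follows from writing a rational function
  on each edge as a sum of hinges \<open>max 0 (t - u)\<close>; it turns everything else into moving chips by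
  hand or into real arithmetic with integer unknowns.

  \<^emph>\<open>Lower bound.\<close> The theta graph has genus 2, so a divisor of degree 4 on it has rank 2. Concretely,
  four chips can be moved so that both vertices carry one, and \<open>V1 + V2\<close> is equivalent to \<open>x\<close> plus
  the mirror image of \<open>x\<close> on its edge; using this twice, four chips on the theta graph can be moved
  so that two of them lie at any given \<open>x\<close> (\<open>degree_4_contains_double\<close>). On a loop, \<open>2 * q j\<close> is
  equivalent to any point of the loop plus its mirror image. Hence every divisor equivalent to four
  chips on the theta graph has rank at least 1 on \<open>G\<close> (\<open>rank_ge_1\<close>). Given two points \<open>a\<close>, \<open>b\<close> of \<open>G\<close>,
  doubling them (on the theta graph) or adding their mirror images (on a loop) gives such a divisor
  that contains \<open>a + b\<close>.

  \<^emph>\<open>Upper bound.\<close> Let \<open>m j\<close> be the midpoint of the loop \<open>j\<close>, and let primes denote mirror images on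
  the edges of the theta graph. No divisor \<open>m 0 + m 1 + (q 1)' + T\<close> has rank at least 1 (\<open>no_rank_1_above\<close>).
  Otherwise one could remove a point \<open>Q\<close> inside the loop at \<open>q 2\<close>, different from \<open>T\<close>, and find an
  equivalent effective divisor \<open>E\<close> of degree 3. A loop inside which \<open>E\<close> has no chip forces the sum of
  positions there to be a multiple of the length of the loop. So \<open>E\<close> has a chip inside the loop at
  \<open>q 2\<close>, one inside the loop at \<open>q 0\<close> unless \<open>T = m 0\<close>, and one inside the loop at \<open>q 1\<close> unless
  \<open>T = m 1\<close>. After contraction of the loops this means, for some point \<open>z\<close>,
  \<^item> \<open>(q 1)' + T \<sim> 2 * q 2\<close> if \<open>T\<close> is neither \<open>m 0\<close> nor \<open>m 1\<close>;
  \<^item> \<open>(q 1)' + (q 2)' \<sim> q 2 + z\<close> if \<open>T = m 0\<close>, since \<open>2 * q 0 \<sim> q 2 + (q 2)'\<close> for the midpoint \<open>q 0\<close>;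
  \<^item> \<open>q 1 + (q 2)' \<sim> q 2 + z\<close> if \<open>T = m 1\<close>, since \<open>q 1 + (q 1)' \<sim> q 2 + (q 2)'\<close>.
  All three are impossible (\<open>double_rigid\<close>, \<open>pair_rigid\<close>): two chips inside different edges cannot
  move at all, and \<open>2 * q 2\<close> can only spread symmetrically along its own edge, because a function that
  takes different values at the two vertices needs slopes on all three edges at once and hence
  three chips.
\<close>

section \<open>Weights of divisors\<close>

text \<open>
  The linear extension of \<open>w\<close> to divisors. Degree, moments and values of piecewise linear functions
  are all of this form, so that one additivity law serves for each of them.
\<close>

definition weight :: "('a \<Rightarrow> real) \<Rightarrow> ('a \<Rightarrow>\<^sub>0 int) \<Rightarrow> real" where
  "weight w D = (\<Sum>p\<in>Poly_Mapping.keys D. of_int (Poly_Mapping.lookup D p) * w p)"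

lemma weight_superset:
  assumes "finite A" "Poly_Mapping.keys D \<subseteq> A"
  shows "weight w D = (\<Sum>p\<in>A. of_int (Poly_Mapping.lookup D p) * w p)"
  unfolding weight_def
  by (rule sum.mono_neutral_left) (use assms in \<open>auto simp: in_keys_iff\<close>)

lemma weight_add [simp]: "weight w (D + D') = weight w D + weight w D'"
proof -
  let ?A = "Poly_Mapping.keys D \<union> Poly_Mapping.keys D'"
  have "weight w (D + D') = (\<Sum>p\<in>?A. of_int (Poly_Mapping.lookup (D + D') p) * w p)"
    by (intro weight_superset) (use Poly_Mapping.keys_add[of D D'] in auto)
  also have "\<dots> = weight w D + weight w D'"
    by (simp add: weight_superset[of ?A] lookup_add algebra_simps sum.distrib)
  finally show ?thesis .
qed

lemma weight_zero [simp]: "weight w 0 = 0"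
  by (simp add: weight_def)

lemma weight_uminus [simp]: "weight w (- D) = - weight w D"
  using weight_add[of w D "- D"] by simp

lemma weight_diff [simp]: "weight w (D - D') = weight w D - weight w D'"
  using weight_add[of w D "- D'"] by simp

lemma weight_single [simp]: "weight w (Poly_Mapping.single p m) = of_int m * w p"
  by (simp add: weight_def)

lemma weight_sum [simp]: "weight w (\<Sum>x\<in>A. f x) = (\<Sum>x\<in>A. weight w (f x))"
  by (induction A rule: infinite_finite_induct) auto

lemma weight_cong:
  "(\<And>p. p \<in> Poly_Mapping.keys D \<Longrightarrow> w p = w' p) \<Longrightarrow> weight w D = weight w' D"
  by (simp add: weight_def)

lemma weight_fun_diff: "weight (\<lambda>p. w p - w' p) D = weight w D - weight w' D"
  by (simp add: weight_def algebra_simps sum_subtractf)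

definition total :: "('a \<Rightarrow>\<^sub>0 int) \<Rightarrow> int" where
  "total D = (\<Sum>p\<in>Poly_Mapping.keys D. Poly_Mapping.lookup D p)"

lemma of_int_total: "of_int (total D) = weight (\<lambda>_. 1) D"
  by (simp add: total_def weight_def)

lemma weight_const: "weight (\<lambda>_. x) D = of_int (total D) * x"
  by (simp add: total_def weight_def sum_distrib_right)

lemma div_degree_total: "div_degree D = total D"
  by (simp add: div_degree_def total_def)

lemma of_int_div_degree: "of_int (div_degree D) = weight (\<lambda>_. 1) D"
  by (simp add: div_degree_total of_int_total)

lemma div_degree_simps [simp]:
  "div_degree (D + D') = div_degree D + div_degree D'"
  "div_degree (D - D') = div_degree D - div_degree D'"
  "div_degree (Poly_Mapping.single p m) = m" "div_degree 0 = 0"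
  by (simp_all add: of_int_div_degree flip: of_int_eq_iff[where 'a = real])


section \<open>Piecewise linear functions as sums of hinges\<close>

text \<open>
  The function with value \<open>k\<close> and right slope \<open>s\<close> at \<open>0\<close> whose slope jumps by \<open>lookup a u\<close> at \<open>u\<close>.
  Taking the jumps as a finitely supported map makes \<open>a\<close> the divisor of the function inside an edge.
\<close>

definition hinge :: "real \<Rightarrow> int \<Rightarrow> (real \<Rightarrow>\<^sub>0 int) \<Rightarrow> real \<Rightarrow> real" where
  "hinge k s a t = k + of_int s * t + weight (\<lambda>u. max 0 (t - u)) a"

lemma hinge_0: "Poly_Mapping.keys a \<subseteq> {0<..<b} \<Longrightarrow> hinge k s a 0 = k"
  unfolding hinge_def
  by (subst weight_cong[where w' = "\<lambda>_. 0"]) (auto simp: weight_const)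

lemma hinge_end:
  assumes "Poly_Mapping.keys a \<subseteq> {0<..<b}"
  shows "hinge k s a b = k + of_int s * b + weight (\<lambda>u. b - u) a"
  unfolding hinge_def by (subst weight_cong[where w' = "\<lambda>u. b - u"]) (use assms in auto)

lemma affine_on_closed_interval:
  fixes g :: "real \<Rightarrow> real"
  assumes "continuous_on {x..y} g" "x < y" "\<And>t. t \<in> {x<..<y} \<Longrightarrow> g t = m * t + k" "t \<in> {x..y}"
  shows "g t = m * t + k"
proof -
  have "g t - m * t = k"
  proof (rule continuous_constant_on_closure[where S = "{x<..<y}" and f = "\<lambda>t. g t - m * t"])
    show "continuous_on (closure {x<..<y}) (\<lambda>t. g t - m * t)"
      using assms by (auto intro!: continuous_intros simp: closure_greaterThanLessThan)
  qed (use assms in \<open>auto simp: closure_greaterThanLessThan\<close>)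
  then show ?thesis by simp
qed

text \<open>
  Induction on the number of exceptional points: beyond the last one, \<open>u\<close>, the function is affine,
  and the hinge at \<open>u\<close> corrects the final slope \<open>s + total a\<close> of the form obtained on \<open>{0..u}\<close>.
\<close>

lemma piecewise_affine_imp_hinge:
  assumes "finite S" "0 < b" "continuous_on {0..b} g"
    and "\<And>x y. 0 \<le> x \<Longrightarrow> x < y \<Longrightarrow> y \<le> b \<Longrightarrow> S \<inter> {x<..<y} = {} \<Longrightarrow>
           \<exists>m::int. \<exists>k. \<forall>t\<in>{x<..<y}. g t = of_int m * t + k"
  shows "\<exists>k s a. Poly_Mapping.keys a \<subseteq> {0<..<b} \<and> (\<forall>t\<in>{0..b}. g t = hinge k s a t)"
  using assms(2-)
proof (induction "card (S \<inter> {0<..<b})" arbitrary: b rule: less_induct)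
  case less
  show ?case
  proof (cases "S \<inter> {0<..<b} = {}")
    case True
    obtain m :: int and k where "\<forall>t\<in>{0<..<b}. g t = of_int m * t + k"
      using less.prems(3)[of 0 b] less.prems(1) True by auto
    then have "g t = of_int m * t + k" if "t \<in> {0..b}" for t
      using affine_on_closed_interval[of 0 b g m k t] less.prems that by auto
    then show ?thesis
      by (intro exI[of _ k] exI[of _ m] exI[of _ 0]) (auto simp: hinge_def)
  next
    case False
    define u where "u = Max (S \<inter> {0<..<b})"
    have fin: "finite (S \<inter> {0<..<b})" using assms(1) by simp
    have u: "u \<in> S" "0 < u" "u < b"
      using Max_in[OF fin False] by (auto simp: u_def)
    have umax: "v \<le> u" if "v \<in> S" "0 < v" "v < b" for v
      unfolding u_def by (rule Max_ge[OF fin]) (use that in auto)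
    have "S \<inter> {u<..<b} = {}"
      using umax u(2) by fastforce
    then obtain m :: int and k' where "\<forall>t\<in>{u<..<b}. g t = of_int m * t + k'"
      using less.prems(3)[of u b] u by auto
    then have right: "g t = of_int m * t + k'" if "t \<in> {u..b}" for t
      using affine_on_closed_interval[of u b g m k' t] that u
        continuous_on_subset[OF less.prems(2), of "{u..b}"] by auto
    have "S \<inter> {0<..<u} \<subset> S \<inter> {0<..<b}"
      using u by auto
    then have "card (S \<inter> {0<..<u}) < card (S \<inter> {0<..<b})"
      by (rule psubset_card_mono[OF fin])
    then have "\<exists>k s a. Poly_Mapping.keys a \<subseteq> {0<..<u} \<and> (\<forall>t\<in>{0..u}. g t = hinge k s a t)"
      using u less.prems(3)
      by (intro less.hyps continuous_on_subset[OF less.prems(2)]) auto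
    then obtain k s a where a: "Poly_Mapping.keys a \<subseteq> {0<..<u}"
      and left: "\<And>t. t \<in> {0..u} \<Longrightarrow> g t = hinge k s a t"
      by blast
    define a' where "a' = a + Poly_Mapping.single u (m - s - total a)"
    have "Poly_Mapping.keys a' \<subseteq> Poly_Mapping.keys a \<union> {u}"
      unfolding a'_def using Poly_Mapping.keys_add[of a] by (fastforce split: if_splits)
    then have "Poly_Mapping.keys a' \<subseteq> {0<..<b}"
      using a u by fastforce
    moreover have "g t = hinge k s a' t" if t: "t \<in> {0..b}" for t
    proof (cases "t \<le> u")
      case True
      then show ?thesis
        using left[of t] t by (simp add: hinge_def a'_def)
    next
      case False
      have tail: "hinge k s a x = k + of_int s * x + (of_int (total a) * x - weight (\<lambda>v. v) a)"
        if "u \<le> x" for x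
      proof -
        have "weight (\<lambda>v. max 0 (x - v)) a = weight (\<lambda>v. x - v) a"
          by (rule weight_cong) (use a that in auto)
        then show ?thesis
          by (simp add: hinge_def weight_fun_diff weight_const)
      qed
      have "g t = g u + of_int m * (t - u)"
        using right[of t] right[of u] False t u by (auto simp: algebra_simps)
      then show ?thesis
        using left[of u] tail[of u] tail[of t] False u
        by (simp add: hinge_def a'_def algebra_simps)
    qed
    ultimately show ?thesis by blast
  qed
qed

lemma integral_pl_on_imp_hinge:
  assumes "0 < b" "integral_pl_on 0 b g"
  obtains k s a where "Poly_Mapping.keys a \<subseteq> {0<..<b}" "\<And>t. t \<in> {0..b} \<Longrightarrow> g t = hinge k s a t"
proof -
  obtain S where "finite S" "continuous_on {0..b} g"
    "\<And>x y. 0 \<le> x \<Longrightarrow> x < y \<Longrightarrow> y \<le> b \<Longrightarrow> S \<inter> {x<..<y} = {} \<Longrightarrow>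
           \<exists>m::int. \<exists>k. \<forall>t\<in>{x<..<y}. g t = of_int m * t + k"
    using assms(2) unfolding integral_pl_on_def by metis
  from piecewise_affine_imp_hinge[OF this(1) assms(1) this(2,3)] show ?thesis
    using that by blast
qed

lemma hinge_imp_integral_pl_on:
  assumes "\<And>t. t \<in> {x..y} \<Longrightarrow> g t = hinge k s a t"
  shows "integral_pl_on x y g"
  unfolding integral_pl_on_def
proof (intro conjI exI[of _ "Poly_Mapping.keys a"] allI impI)
  have "continuous_on {x..y} (hinge k s a)"
    unfolding hinge_def weight_def by (intro continuous_intros)
  then show "continuous_on {x..y} g"
    using assms by (subst continuous_on_cong[OF refl, of _ _ "hinge k s a"]) auto
next
  fix x' y' assume *: "x \<le> x' \<and> x' < y' \<and> y' \<le> y \<and> Poly_Mapping.keys a \<inter> {x'<..<y'} = {}"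
  let ?K = "\<lambda>P. \<Sum>u | u \<in> Poly_Mapping.keys a \<and> u \<le> x'. P u"
  define m where "m = ?K (Poly_Mapping.lookup a)"
  have "g t = of_int (s + m) * t + (k - ?K (\<lambda>u. of_int (Poly_Mapping.lookup a u) * u))"
    if t: "t \<in> {x'<..<y'}" for t
  proof -
    have "weight (\<lambda>u. max 0 (t - u)) a = ?K (\<lambda>u. of_int (Poly_Mapping.lookup a u) * (t - u))"
      unfolding weight_def
      by (rule sum.mono_neutral_cong_right) (use * t in \<open>force+\<close>)
    then show ?thesis
      using t * assms[of t]
      by (simp add: hinge_def m_def algebra_simps sum_subtractf sum_distrib_left)
  qed
  then show "\<exists>m::int. \<exists>k. \<forall>t\<in>{x'<..<y'}. g t = of_int m * t + k" by blast
qed simp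

text \<open>
  One-sided derivatives are taken within the closed half-lines, which contain \<open>t\<close>, so that the
  function may be replaced by one that agrees with it on that side only.
\<close>

lemma max_has_right_derivative:
  "((\<lambda>x. max 0 (x - u)) has_vector_derivative (if u \<le> t then 1 else 0)) (at (t::real) within {t..})"
proof (cases "u \<le> t")
  case True
  have "((\<lambda>x. x - u) has_vector_derivative 1) (at t within {t..})"
    by (auto intro!: derivative_eq_intros)
  then have "((\<lambda>x. max 0 (x - u)) has_vector_derivative 1) (at t within {t..})"
    by (rule has_vector_derivative_transform_within[where d = 1]) (use True in auto)
  with True show ?thesis by simp
next
  case False
  have "((\<lambda>x. 0) has_vector_derivative (0::real)) (at t within {t..})"
    by simp
  then have "((\<lambda>x. max 0 (x - u)) has_vector_derivative 0) (at t within {t..})"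
    by (rule has_vector_derivative_transform_within[where d = "u - t"])
      (use False in \<open>auto simp: dist_real_def\<close>)
  with False show ?thesis by simp
qed

lemma max_has_left_derivative:
  "((\<lambda>x. max 0 (x - u)) has_vector_derivative (if u < t then 1 else 0)) (at (t::real) within {..t})"
proof (cases "u < t")
  case True
  have "((\<lambda>x. x - u) has_vector_derivative 1) (at t within {..t})"
    by (auto intro!: derivative_eq_intros)
  then have "((\<lambda>x. max 0 (x - u)) has_vector_derivative 1) (at t within {..t})"
    by (rule has_vector_derivative_transform_within[where d = "t - u"])
      (use True in \<open>auto simp: dist_real_def\<close>)
  with True show ?thesis by simp
next
  case False
  have "((\<lambda>x. 0) has_vector_derivative (0::real)) (at t within {..t})"
    by simp
  then have "((\<lambda>x. max 0 (x - u)) has_vector_derivative 0) (at t within {..t})"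
    by (rule has_vector_derivative_transform_within[where d = 1]) (use False in auto)
  with False show ?thesis by simp
qed

lemma hinge_right_derivative:
  assumes "\<And>x. x \<in> {0..b} \<Longrightarrow> g x = hinge k s a x" "0 \<le> t" "t < b"
  shows "vector_derivative g (at_right t) = of_int s + weight (\<lambda>u. if u \<le> t then 1 else 0) a"
proof (rule vector_derivative_within)
  have "(hinge k s a has_vector_derivative of_int s + weight (\<lambda>u. if u \<le> t then 1 else 0) a)
          (at t within {t..})"
    unfolding hinge_def weight_def
    by (rule derivative_eq_intros max_has_right_derivative refl | simp)+
  then have "(g has_vector_derivative of_int s + weight (\<lambda>u. if u \<le> t then 1 else 0) a)
          (at t within {t..})"
    by (rule has_vector_derivative_transform_within[where d = "b - t"])
      (use assms in \<open>auto simp: dist_real_def\<close>)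
  then show "(g has_vector_derivative of_int s + weight (\<lambda>u. if u \<le> t then 1 else 0) a) (at_right t)"
    by (rule has_vector_derivative_within_subset) auto
qed simp

lemma hinge_left_derivative:
  assumes "\<And>x. x \<in> {0..b} \<Longrightarrow> g x = hinge k s a x" "0 < t" "t \<le> b"
  shows "vector_derivative g (at_left t) = of_int s + weight (\<lambda>u. if u < t then 1 else 0) a"
proof (rule vector_derivative_within)
  have "(hinge k s a has_vector_derivative of_int s + weight (\<lambda>u. if u < t then 1 else 0) a)
          (at t within {..t})"
    unfolding hinge_def weight_def
    by (rule derivative_eq_intros max_has_left_derivative refl | simp)+
  then have "(g has_vector_derivative of_int s + weight (\<lambda>u. if u < t then 1 else 0) a)
          (at t within {..t})"
    by (rule has_vector_derivative_transform_within[where d = t])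
      (use assms in \<open>auto simp: dist_real_def\<close>)
  then show "(g has_vector_derivative of_int s + weight (\<lambda>u. if u < t then 1 else 0) a) (at_left t)"
    by (rule has_vector_derivative_within_subset) auto
qed simp


section \<open>Linear equivalence through hinge data\<close>

text \<open>
  The contribution of the interior of the edge \<open>e\<close> to the divisor of a function with slope jumps \<open>a\<close>.
\<close>

definition along :: "'e \<Rightarrow> (real \<Rightarrow>\<^sub>0 int) \<Rightarrow> ('v, 'e) graph_div" where
  "along e a = (\<Sum>u\<in>Poly_Mapping.keys a. Poly_Mapping.single (Inner e u) (Poly_Mapping.lookup a u))"

lemma weight_along [simp]: "weight w (along e a) = weight (\<lambda>u. w (Inner e u)) a"
  by (simp add: along_def) (simp add: weight_def)

lemma lookup_along:
  "Poly_Mapping.lookup (along e a) p =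
     (case p of Vertex v \<Rightarrow> 0 | Inner e' t \<Rightarrow> if e' = e then Poly_Mapping.lookup a t else 0)"
proof (cases p)
  case (Inner e' t)
  have "Poly_Mapping.lookup (along e a) p =
      (\<Sum>u\<in>Poly_Mapping.keys a. if u = t then (if e' = e then Poly_Mapping.lookup a u else 0) else 0)"
    unfolding along_def by (auto simp: lookup_sum lookup_single when_def Inner intro!: sum.cong)
  then show ?thesis
    by (simp add: Inner in_keys_iff)
qed (simp add: along_def lookup_sum lookup_single)

text \<open>
  The divisor of a function that has initial slope \<open>s e\<close> and slope jumps \<open>a e\<close> along each edge \<open>e\<close>;
  at the target of \<open>e\<close> its outgoing slope is \<open>- (s e + total (a e))\<close>. The formula is a sum of
  point masses, so the weight of such a divisor can be read off edge by edge.
\<close>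

definition hinge_div ::
  "('v, 'e) mgraph \<Rightarrow> ('e \<Rightarrow> int) \<Rightarrow> ('e \<Rightarrow> real \<Rightarrow>\<^sub>0 int) \<Rightarrow> ('v, 'e) graph_div" where
  "hinge_div G s a = (\<Sum>e\<in>edges G.
     Poly_Mapping.single (src G e) (s e) - Poly_Mapping.single (tgt G e) (s e + total (a e))
     + along e (a e))"

lemma weight_hinge_div:
  "weight w (hinge_div G s a) = (\<Sum>e\<in>edges G.
     of_int (s e) * w (src G e) - of_int (s e + total (a e)) * w (tgt G e)
     + weight (\<lambda>u. w (Inner e u)) (a e))"
  by (simp add: hinge_div_def)

lemma lookup_hinge_div:
  "Poly_Mapping.lookup (hinge_div G s a) p = (\<Sum>e\<in>edges G.
     (if src G e = p then s e else 0) - (if tgt G e = p then s e + total (a e) else 0)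
     + (case p of Vertex v \<Rightarrow> 0 | Inner e' t \<Rightarrow> if e' = e then Poly_Mapping.lookup (a e) t else 0))"
  by (simp add: hinge_div_def lookup_sum lookup_add lookup_minus lookup_single lookup_along when_def)

lemma divisor_hinge_div:
  assumes "wf_mgraph G" "\<And>e. e \<in> edges G \<Longrightarrow> Poly_Mapping.keys (a e) \<subseteq> {0<..<len G e}"
  shows "divisor G (hinge_div G s a)"
proof -
  have "Poly_Mapping.lookup (hinge_div G s a) p = 0" if p: "p \<notin> points G" for p
    unfolding lookup_hinge_div
  proof (rule sum.neutral, rule ballI)
    fix e assume e: "e \<in> edges G"
    have "(case p of Vertex v \<Rightarrow> 0 | Inner e' t \<Rightarrow> if e' = e then Poly_Mapping.lookup (a e) t else 0) = 0"
      using p e assms(2)[OF e] by (auto simp: points_def in_keys_iff subset_iff split: point.splits)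
    moreover have "src G e \<noteq> p" "tgt G e \<noteq> p"
      using p e assms(1) by (auto simp: wf_mgraph_def)
    ultimately show "(if src G e = p then s e else 0) - (if tgt G e = p then s e + total (a e) else 0)
     + (case p of Vertex v \<Rightarrow> 0 | Inner e' t \<Rightarrow> if e' = e then Poly_Mapping.lookup (a e) t else 0) = 0"
      by simp
  qed
  then show ?thesis
    by (auto simp: divisor_def in_keys_iff)
qed

lemma edge_map_0 [simp]: "edge_map G e 0 = src G e"
  by (simp add: edge_map_def)

text \<open>
  The tangent directions in a point are the ends of edges glued to it and, for a point inside an
  edge, the two directions along that edge.
\<close>

lemma directions_at_point:
  assumes "wf_mgraph G" "p \<in> points G"
  shows "{(e, t). e \<in> edges G \<and> 0 \<le> t \<and> t < len G e \<and> edge_map G e t = p} =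
      (\<lambda>e. (e, 0)) ` {e \<in> edges G. src G e = p} \<union> {(e, t). p = Inner e t}"
    and "{(e, t). e \<in> edges G \<and> 0 < t \<and> t \<le> len G e \<and> edge_map G e t = p} =
      (\<lambda>e. (e, len G e)) ` {e \<in> edges G. tgt G e = p} \<union> {(e, t). p = Inner e t}"
  using assms
  by (auto simp: wf_mgraph_def edge_map_def points_def image_iff split: if_splits)

text \<open>
  The two sums are the right and the left slope at \<open>t\<close> caused by hinges with jumps \<open>a\<close>.
\<close>

lemma weight_jump:
  fixes t :: real
  shows "weight (\<lambda>u. if u \<le> t then 1 else 0) a - weight (\<lambda>u. if u < t then 1 else 0) a =
     of_int (Poly_Mapping.lookup a t)"
proof -
  have "weight (\<lambda>u. if u \<le> t then 1 else 0) a - weight (\<lambda>u. if u < t then 1 else 0) a =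
      weight (\<lambda>u. if u = t then 1 else 0) a"
    unfolding weight_fun_diff[symmetric] by (rule weight_cong) auto
  also have "\<dots> = of_int (Poly_Mapping.lookup a t)"
    by (simp add: weight_def if_distrib[of "\<lambda>x. _ * x"] in_keys_iff cong: if_cong)
  finally show ?thesis .
qed

lemma slope_sum_hinges:
  assumes wf: "wf_mgraph G" and p: "p \<in> points G"
    and keys: "\<And>e. e \<in> edges G \<Longrightarrow> Poly_Mapping.keys (a e) \<subseteq> {0<..<len G e}"
    and f: "\<And>e t. e \<in> edges G \<Longrightarrow> t \<in> {0..len G e} \<Longrightarrow> f (edge_map G e t) = hinge (k e) (s e) (a e) t"
  shows "slope_sum G f p = of_int (Poly_Mapping.lookup (hinge_div G s a) p)"
proof -
  let ?r = "\<lambda>(e, t). vector_derivative (f \<circ> edge_map G e) (at_right t)"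
  let ?l = "\<lambda>(e, t). - vector_derivative (f \<circ> edge_map G e) (at_left t)"
  let ?I = "{(e, t). p = Inner e t}"
  have fin: "finite (edges G)" and len: "\<And>e. e \<in> edges G \<Longrightarrow> 0 < len G e"
    using wf by (auto simp: wf_mgraph_def)
  have finI: "finite ?I"
    by (cases p) auto
  have inner: "e \<in> edges G" "0 < t" "t < len G e" if "p = Inner e t" for e t
    using p that by (auto simp: points_def)
  have r: "?r (e, t) = of_int (s e) + weight (\<lambda>u. if u \<le> t then 1 else 0) (a e)"
    if "e \<in> edges G" "0 \<le> t" "t < len G e" for e t
    using hinge_right_derivative[of "len G e" "f \<circ> edge_map G e" "k e" "s e" "a e" t] f that by auto
  have l: "?l (e, t) = - of_int (s e) - weight (\<lambda>u. if u < t then 1 else 0) (a e)"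
    if "e \<in> edges G" "0 < t" "t \<le> len G e" for e t
    using hinge_left_derivative[of "len G e" "f \<circ> edge_map G e" "k e" "s e" "a e" t] f that by auto
  have r0: "?r (e, 0) = of_int (s e)" if e: "e \<in> edges G" for e
  proof -
    have "weight (\<lambda>u. if u \<le> 0 then 1 else 0) (a e) = weight (\<lambda>_. 0) (a e)"
      by (rule weight_cong) (use keys[OF e] in force)
    then show ?thesis
      using r[of e 0] len e by (simp add: weight_const)
  qed
  have l1: "?l (e, len G e) = - of_int (s e + total (a e))" if e: "e \<in> edges G" for e
  proof -
    have "weight (\<lambda>u. if u < len G e then 1 else 0) (a e) = weight (\<lambda>_. 1) (a e)"
      by (rule weight_cong) (use keys[OF e] in force)
    then show ?thesis
      using l[of e "len G e"] len e by (simp add: weight_const)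
  qed
  have "slope_sum G f p =
      sum ?r ((\<lambda>e. (e, 0)) ` {e \<in> edges G. src G e = p}) + sum ?r ?I
      + (sum ?l ((\<lambda>e. (e, len G e)) ` {e \<in> edges G. tgt G e = p}) + sum ?l ?I)"
    unfolding slope_sum_def directions_at_point[OF wf p]
    by (intro arg_cong2[where f = "(+)"] sum.union_disjoint) (use fin finI inner in \<open>auto dest: inner\<close>)
  also have "sum ?r ((\<lambda>e. (e, 0)) ` {e \<in> edges G. src G e = p}) =
      (\<Sum>e | e \<in> edges G \<and> src G e = p. of_int (s e))"
    by (subst sum.reindex) (auto simp: inj_on_def r0[simplified] intro!: sum.cong)
  also have "\<dots> = (\<Sum>e\<in>edges G. if src G e = p then of_int (s e) else 0)"
    by (rule sum.inter_filter[OF fin])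
  also have "sum ?l ((\<lambda>e. (e, len G e)) ` {e \<in> edges G. tgt G e = p}) =
      (\<Sum>e | e \<in> edges G \<and> tgt G e = p. - of_int (s e + total (a e)))"
    by (subst sum.reindex) (auto simp: inj_on_def l1[simplified] intro!: sum.cong)
  also have "\<dots> = (\<Sum>e\<in>edges G. if tgt G e = p then - of_int (s e + total (a e)) else 0)"
    by (rule sum.inter_filter[OF fin])
  finally have "slope_sum G f p =
      (\<Sum>e\<in>edges G. if src G e = p then of_int (s e) else 0)
      + (\<Sum>e\<in>edges G. if tgt G e = p then - of_int (s e + total (a e)) else 0) + (sum ?r ?I + sum ?l ?I)"
    by (simp only: ac_simps)
  also have "sum ?r ?I + sum ?l ?I =
      (\<Sum>e\<in>edges G. case p of Vertex v \<Rightarrow> 0 | Inner e' t \<Rightarrow>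
         if e' = e then of_int (Poly_Mapping.lookup (a e) t) else 0)"
  proof (cases p)
    case (Inner e t)
    have "?I = {(e, t)}" using Inner by auto
    then show ?thesis
      using r[of e t] l[of e t] inner[OF Inner] weight_jump[of t "a e"] fin by (simp add: Inner)
  qed simp
  finally show ?thesis
    unfolding lookup_hinge_div of_int_sum
    by (simp add: sum.distrib[symmetric])
      (intro sum.cong, auto split: point.splits)
qed

text \<open>
  Derivatives disappear here: from now on a linear equivalence is a choice of integer slopes and
  jumps for which the values at glued points agree.
\<close>

lemma lin_equiv_iff_hinges:
  assumes wf: "wf_mgraph G"
  shows "lin_equiv G D D' \<longleftrightarrow> (\<exists>f k s a.
    (\<forall>e\<in>edges G. Poly_Mapping.keys (a e) \<subseteq> {0<..<len G e} \<and>
       (\<forall>t\<in>{0..len G e}. f (edge_map G e t) = hinge (k e) (s e) (a e) t)) \<and>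
    D - D' = hinge_div G s a)"
proof
  assume "lin_equiv G D D'"
  then obtain f where rat: "rational_function G f" and D: "divisor_of G f (D - D')"
    by (auto simp: lin_equiv_def)
  have "\<exists>k s a. Poly_Mapping.keys a \<subseteq> {0<..<len G e} \<and>
       (\<forall>t\<in>{0..len G e}. f (edge_map G e t) = hinge k s a t)" if e: "e \<in> edges G" for e
  proof -
    have "integral_pl_on 0 (len G e) (f \<circ> edge_map G e)" "0 < len G e"
      using rat wf e by (auto simp: rational_function_def wf_mgraph_def)
    from integral_pl_on_imp_hinge[OF this(2,1)] show ?thesis
      by (metis comp_apply)
  qed
  then obtain k s a where *: "\<And>e. e \<in> edges G \<Longrightarrow> Poly_Mapping.keys (a e) \<subseteq> {0<..<len G e}"
    "\<And>e t. e \<in> edges G \<Longrightarrow> t \<in> {0..len G e} \<Longrightarrow> f (edge_map G e t) = hinge (k e) (s e) (a e) t"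
    by metis
  have "D - D' = hinge_div G s a"
  proof (rule poly_mapping_eqI)
    fix p
    show "Poly_Mapping.lookup (D - D') p = Poly_Mapping.lookup (hinge_div G s a) p"
    proof (cases "p \<in> points G")
      case True
      then have "real_of_int (Poly_Mapping.lookup (D - D') p) =
          real_of_int (Poly_Mapping.lookup (hinge_div G s a) p)"
        using slope_sum_hinges[OF wf True *] D by (simp add: divisor_of_def)
      then show ?thesis by simp
    next
      case False
      then show ?thesis
        using D divisor_hinge_div[OF wf *(1), of s] unfolding divisor_of_def divisor_def
        by (metis in_keys_iff subsetD)
    qed
  qed
  with * show "\<exists>f k s a.
    (\<forall>e\<in>edges G. Poly_Mapping.keys (a e) \<subseteq> {0<..<len G e} \<and>
       (\<forall>t\<in>{0..len G e}. f (edge_map G e t) = hinge (k e) (s e) (a e) t)) \<and>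
    D - D' = hinge_div G s a" by blast
next
  assume "\<exists>f k s a.
    (\<forall>e\<in>edges G. Poly_Mapping.keys (a e) \<subseteq> {0<..<len G e} \<and>
       (\<forall>t\<in>{0..len G e}. f (edge_map G e t) = hinge (k e) (s e) (a e) t)) \<and>
    D - D' = hinge_div G s a"
  then obtain f k s a where *: "\<And>e. e \<in> edges G \<Longrightarrow> Poly_Mapping.keys (a e) \<subseteq> {0<..<len G e}"
    "\<And>e t. e \<in> edges G \<Longrightarrow> t \<in> {0..len G e} \<Longrightarrow> f (edge_map G e t) = hinge (k e) (s e) (a e) t"
    and D: "D - D' = hinge_div G s a"
    by blast
  have "rational_function G f"
    unfolding rational_function_def
    using * by (auto intro!: hinge_imp_integral_pl_on)
  moreover have "divisor_of G f (D - D')"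
    unfolding divisor_of_def D
    using divisor_hinge_div[OF wf *(1)] slope_sum_hinges[OF wf _ *] by simp
  ultimately show "lin_equiv G D D'"
    by (auto simp: lin_equiv_def)
qed


section \<open>Linear equivalence on a theta graph with loops\<close>

text \<open>
  The period lattice of the theta graph, formed by the vectors \<open>s i * l i\<close> with \<open>s\<close> of sum zero,
  together with the constant vectors. A function with slope \<open>s i\<close> at \<open>V1\<close> and slope jumps of moment
  \<open>x i\<close> along the edge \<open>i\<close> rises by \<open>s i * l i + x i\<close> from \<open>V1\<close> to \<open>V2\<close>; the rise \<open>L\<close> has to be the
  same for all three edges.
\<close>

definition period :: "(nat \<Rightarrow> real) \<Rightarrow> (nat \<Rightarrow> real) \<Rightarrow> bool" where
  "period l x \<longleftrightarrow> (\<exists>s :: nat \<Rightarrow> int. s 0 + s 1 + s 2 = 0 \<and>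
     (\<exists>L. \<forall>i\<le>2. of_int (s i) * l i + x i = L))"

lemma periodI:
  fixes s :: "nat \<Rightarrow> int"
  assumes "s 0 + s 1 + s 2 = 0" "\<And>i. i \<le> 2 \<Longrightarrow> of_int (s i) * l i + x i = L"
  shows "period l x"
  using assms unfolding period_def by blast

lemma period_add:
  assumes "period l x" "period l y"
  shows "period l (\<lambda>i. x i + y i)"
proof -
  obtain s L where s: "s 0 + s 1 + s 2 = 0" "\<And>i. i \<le> 2 \<Longrightarrow> real_of_int (s i) * l i + x i = L"
    using assms(1) by (auto simp: period_def)
  obtain s' L' where s': "s' 0 + s' 1 + s' 2 = 0" "\<And>i. i \<le> 2 \<Longrightarrow> real_of_int (s' i) * l i + y i = L'"
    using assms(2) by (auto simp: period_def)
  show ?thesis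
  proof (rule periodI[of "\<lambda>i. s i + s' i" _ _ "L + L'"])
    fix i :: nat assume "i \<le> 2"
    then show "of_int (s i + s' i) * l i + (x i + y i) = L + L'"
      using s(2)[of i] s'(2)[of i] by (simp add: algebra_simps)
  qed (use s s' in simp)
qed

lemma period_minus:
  assumes "period l x"
  shows "period l (\<lambda>i. - x i)"
proof -
  obtain s L where s: "s 0 + s 1 + s 2 = 0" "\<And>i. i \<le> 2 \<Longrightarrow> real_of_int (s i) * l i + x i = L"
    using assms(1) by (auto simp: period_def)
  show ?thesis
  proof (rule periodI[of "\<lambda>i. - s i" _ _ "- L"])
    fix i :: nat assume "i \<le> 2"
    then show "of_int (- s i) * l i + - x i = - L"
      using s(2)[of i] by (simp add: algebra_simps)
  qed (use s in simp)
qed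

lemma period_diff: "period l x \<Longrightarrow> period l y \<Longrightarrow> period l (\<lambda>i. x i - y i)"
  using period_add[OF _ period_minus, of l x y] by simp

lemma period_const: "period l (\<lambda>_. x)"
  by (rule periodI[of "\<lambda>_. 0"]) auto

lemma period_shift:
  assumes "period l x" "\<And>i. i \<le> 2 \<Longrightarrow> y i = x i + d"
  shows "period l y"
proof -
  obtain s L where s: "s 0 + s 1 + s 2 = 0" "\<And>i. i \<le> 2 \<Longrightarrow> real_of_int (s i) * l i + x i = L"
    using assms(1) by (auto simp: period_def)
  show ?thesis
  proof (rule periodI[of s _ _ "L + d"])
    show "of_int (s i) * l i + y i = L + d" if "i \<le> 2" for i
      using s(2)[OF that] assms(2)[OF that] by simp
  qed (use s in simp)
qed

locale theta_with_loops =
  fixes n :: nat and l c :: "nat \<Rightarrow> real" and q :: "nat \<Rightarrow> (vertex, edge) point"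
  assumes l_pos: "\<And>i. i \<le> 2 \<Longrightarrow> 0 < l i"
    and c_pos: "\<And>j. j \<le> n \<Longrightarrow> 0 < c j"
    and q_inner: "\<And>j. j \<le> n \<Longrightarrow> \<exists>i u. i \<le> 2 \<and> 0 < u \<and> u < l i \<and> q j = Inner (Seg i) u"
begin

abbreviation "G \<equiv> theta_loops l q c n"

lemma edges_G: "edges G = Seg ` {0, 1, 2} \<union> Loop ` {0..n}"
  and len_G [simp]: "len G (Seg i) = l i" "len G (Loop j) = c j"
  and src_G [simp]: "src G (Seg i) = Vertex V1" "src G (Loop j) = q j"
  and tgt_G [simp]: "tgt G (Seg i) = Vertex V2" "tgt G (Loop j) = q j"
  by (simp_all add: theta_loops_def)

lemma Seg_edge_iff [simp]: "Seg i \<in> edges G \<longleftrightarrow> i \<le> 2"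
  and Loop_edge_iff [simp]: "Loop j \<in> edges G \<longleftrightarrow> j \<le> n"
  by (auto simp: edges_G)

lemma points_G:
  "Vertex v \<in> points G"
  "Inner (Seg i) u \<in> points G \<longleftrightarrow> i \<le> 2 \<and> 0 < u \<and> u < l i"
  "Inner (Loop j) u \<in> points G \<longleftrightarrow> j \<le> n \<and> 0 < u \<and> u < c j"
  by (cases v; auto simp: points_def theta_loops_def)+

lemma wf_G: "wf_mgraph G"
proof (rule wf_mgraph_theta_loops)
  show "q j \<in> points (theta l)" if "j \<le> n" for j
    using q_inner[OF that] by (auto simp: points_def theta_def)
qed (auto intro: l_pos c_pos)

lemma sum_edges_G:
  "(\<Sum>e\<in>edges G. \<phi> e) = \<phi> (Seg 0) + \<phi> (Seg 1) + \<phi> (Seg 2) + (\<Sum>j\<in>{0..n}. \<phi> (Loop j))"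
  unfolding edges_G
  by (subst sum.union_disjoint) (auto simp: sum.reindex inj_on_def add.assoc)

definition retract :: "(vertex, edge) point \<Rightarrow> (vertex, edge) point" where
  "retract p = (case p of Inner (Loop j) u \<Rightarrow> q j | _ \<Rightarrow> p)"

text \<open>
  A unit slope jump at distance \<open>l i - u\<close> from \<open>V2\<close> changes the value at \<open>V2\<close> by \<open>l i - u\<close>. The vertex
  \<open>V1\<close> lies on all three edges and is counted as the beginning of the edge \<open>Seg 0\<close>; any other choice
  changes the moments by an element of the period lattice.
\<close>

definition theta_coordinate :: "nat \<Rightarrow> (vertex, edge) point \<Rightarrow> real" where
  "theta_coordinate i p = (case p of
     Vertex V1 \<Rightarrow> if i = 0 then l 0 else 0
   | Inner (Seg k) u \<Rightarrow> if k = i then l i - u else 0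
   | _ \<Rightarrow> 0)"

definition theta_moment :: "nat \<Rightarrow> (vertex, edge) point \<Rightarrow> real" where
  "theta_moment i p = theta_coordinate i (retract p)"

definition loop_moment :: "nat \<Rightarrow> (vertex, edge) point \<Rightarrow> real" where
  "loop_moment j p = (case p of Inner (Loop j') u \<Rightarrow> if j' = j then u else 0 | _ \<Rightarrow> 0)"

lemma theta_moment_simps [simp]:
  "theta_moment i (Vertex V1) = (if i = 0 then l 0 else 0)"
  "theta_moment i (Vertex V2) = 0"
  "theta_moment i (Inner (Seg k) u) = (if k = i then l i - u else 0)"
  "j \<le> n \<Longrightarrow> theta_moment i (Inner (Loop j) u) = theta_moment i (q j)"
  using q_inner[of j] by (auto simp: theta_moment_def retract_def theta_coordinate_def)

lemma loop_moment_simps [simp]: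
  "loop_moment j (Vertex v) = 0" "loop_moment j (Inner (Seg k) u) = 0"
  "loop_moment j (Inner (Loop j') u) = (if j' = j then u else 0)"
  "j' \<le> n \<Longrightarrow> loop_moment j (q j') = 0"
  using q_inner[of j'] by (auto simp: loop_moment_def)

text \<open>
  The loops drop out: the part of the divisor caused by the slopes along a loop has degree zero, and
  all points of the loop have the moments of \<open>q j\<close>.
\<close>

lemma theta_moment_hinge_div:
  assumes "i \<le> 2"
  shows "weight (theta_moment i) (hinge_div G s a) =
    of_int (s (Seg 0) + s (Seg 1) + s (Seg 2)) * theta_moment i (Vertex V1)
    + weight (\<lambda>u. l i - u) (a (Seg i))"
proof -
  have "(\<Sum>j\<in>{0..n}. of_int (s (Loop j)) * theta_moment i (q j)
       - of_int (s (Loop j) + total (a (Loop j))) * theta_moment i (q j)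
       + weight (\<lambda>u. theta_moment i (Inner (Loop j) u)) (a (Loop j))) = 0"
    by (rule sum.neutral) (simp add: weight_const algebra_simps)
  moreover have "i \<in> {0, 1, 2}" using assms by auto
  ultimately show ?thesis
    unfolding weight_hinge_div sum_edges_G by (auto simp: weight_const algebra_simps)
qed

lemma loop_moment_hinge_div:
  assumes "j \<le> n"
  shows "weight (loop_moment j) (hinge_div G s a) = weight (\<lambda>u. u) (a (Loop j))"
proof -
  have "(\<Sum>i\<in>{0..n}. weight (\<lambda>u. if i = j then u else 0) (a (Loop i))) =
      (\<Sum>i\<in>{0..n}. if i = j then weight (\<lambda>u. u) (a (Loop j)) else 0)"
    by (rule sum.cong) (auto simp: weight_const)
  then show ?thesis
    unfolding weight_hinge_div sum_edges_G using assms by (simp add: weight_const)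
qed

lemma div_degree_hinge_div: "div_degree (hinge_div G s a) = 0"
proof -
  have "real_of_int (div_degree (hinge_div G s a)) = 0"
    unfolding of_int_div_degree weight_hinge_div
    by (rule sum.neutral) (simp add: of_int_total)
  then show ?thesis by simp
qed

text \<open>
  The period condition says that the value at \<open>V2\<close> is the same along all three edges, the condition
  on the loop \<open>j\<close> that a function returns to its value at \<open>q j\<close> after going around.
\<close>

lemma lin_equiv_imp_invariants:
  assumes "lin_equiv G D D'"
  shows "divisor G (D - D')" "div_degree D = div_degree D'"
    "period l (\<lambda>i. weight (theta_moment i) (D - D'))"
    "\<And>j. j \<le> n \<Longrightarrow> weight (loop_moment j) (D - D') / c j \<in> \<int>"
proof -
  obtain f k s a where
    keys: "\<And>e. e \<in> edges G \<Longrightarrow> Poly_Mapping.keys (a e) \<subseteq> {0<..<len G e}" and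
    f: "\<And>e t. e \<in> edges G \<Longrightarrow> t \<in> {0..len G e} \<Longrightarrow> f (edge_map G e t) = hinge (k e) (s e) (a e) t" and
    D: "D - D' = hinge_div G s a"
    using assms unfolding lin_equiv_iff_hinges[OF wf_G] by blast
  have ends: "f (src G e) = k e" "f (tgt G e) = k e + of_int (s e) * len G e + weight (\<lambda>u. len G e - u) (a e)"
    if e: "e \<in> edges G" for e
  proof -
    have len: "0 < len G e" using wf_G e by (auto simp: wf_mgraph_def)
    show "f (src G e) = k e"
      using f[OF e, of 0] len hinge_0[OF keys[OF e], of "k e" "s e"] by simp
    show "f (tgt G e) = k e + of_int (s e) * len G e + weight (\<lambda>u. len G e - u) (a e)"
      using f[OF e, of "len G e"] len hinge_end[OF keys[OF e], of "k e" "s e"]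
      by (simp add: edge_map_def)
  qed
  show "divisor G (D - D')"
    unfolding D by (rule divisor_hinge_div[OF wf_G keys])
  have "div_degree (D - D') = 0"
    unfolding D by (rule div_degree_hinge_div)
  then show "div_degree D = div_degree D'" by simp
  let ?S = "s (Seg 0) + s (Seg 1) + s (Seg 2)"
  show "period l (\<lambda>i. weight (theta_moment i) (D - D'))"
  proof (rule periodI[of "\<lambda>i. if i = 0 then s (Seg 0) - ?S else s (Seg i)" _ _ "f (Vertex V2) - f (Vertex V1)"])
    fix i :: nat assume i: "i \<le> 2"
    show "of_int (if i = 0 then s (Seg 0) - ?S else s (Seg i)) * l i + weight (theta_moment i) (D - D') =
        f (Vertex V2) - f (Vertex V1)"
      unfolding D theta_moment_hinge_div[OF i]
      using ends[of "Seg i"] i by (simp add: algebra_simps)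
  qed simp
  fix j assume j: "j \<le> n"
  have "weight (loop_moment j) (D - D') = of_int (s (Loop j) + total (a (Loop j))) * c j"
    unfolding D loop_moment_hinge_div[OF j]
    using ends[of "Loop j"] j by (simp add: weight_fun_diff weight_const algebra_simps)
  then show "weight (loop_moment j) (D - D') / c j \<in> \<int>"
    using c_pos[OF j] by simp
qed

lemma inj_Inner: "inj (Inner e)"
  by (simp add: inj_def)

text \<open>
  The jumps are prescribed by the divisor, except that the points inside a loop also have to be
  compensated at \<open>q j\<close>. This gives the right multiplicity everywhere except possibly at \<open>V2\<close>, and
  there by the degree.
\<close>

lemma hinge_div_surj:
  assumes D: "divisor G D" "div_degree D = 0"
    and s: "s (Seg 0) + s (Seg 1) + s (Seg 2) = Poly_Mapping.lookup D (Vertex V1)"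
  obtains a where "\<And>e. e \<in> edges G \<Longrightarrow> Poly_Mapping.keys (a e) \<subseteq> {0<..<len G e}"
    and "D = hinge_div G s a"
proof -
  let ?at = "\<lambda>i j. case q j of Inner (Seg k) u \<Rightarrow> if k = i
       then Poly_Mapping.single u (total (Poly_Mapping.map_key (Inner (Loop j)) D)) else 0 | _ \<Rightarrow> 0"
  define a where "a e = (case e of
      Seg i \<Rightarrow> Poly_Mapping.map_key (Inner (Seg i)) D + (\<Sum>j\<in>{0..n}. ?at i j)
    | Loop j \<Rightarrow> Poly_Mapping.map_key (Inner (Loop j)) D)" for e
  have a_Loop: "Poly_Mapping.lookup (a (Loop j)) u = Poly_Mapping.lookup D (Inner (Loop j) u)" for j u
    by (simp add: a_def map_key.rep_eq[OF inj_Inner])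
  have a_Seg: "Poly_Mapping.lookup (a (Seg i)) u = Poly_Mapping.lookup D (Inner (Seg i) u)
      + (\<Sum>j\<in>{0..n}. if q j = Inner (Seg i) u then total (a (Loop j)) else 0)" for i u
    unfolding a_def
    by (auto simp: map_key.rep_eq[OF inj_Inner] lookup_add lookup_sum lookup_single when_def
        intro!: sum.cong split: point.splits edge.splits)
  have off: "Poly_Mapping.lookup D p = 0" if "p \<notin> points G" for p
    using D(1) that by (auto simp: divisor_def in_keys_iff)
  have keys: "Poly_Mapping.keys (a e) \<subseteq> {0<..<len G e}" if e: "e \<in> edges G" for e
  proof
    fix u assume u: "u \<in> Poly_Mapping.keys (a e)"
    show "u \<in> {0<..<len G e}"
    proof (cases e)
      case (Loop j)
      then show ?thesis
        using u off[of "Inner (Loop j) u"] by (auto simp: in_keys_iff a_Loop points_G)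
    next
      case (Seg i)
      have "Poly_Mapping.lookup D (Inner (Seg i) u) \<noteq> 0 \<or> (\<exists>j\<in>{0..n}. q j = Inner (Seg i) u)"
      proof (rule ccontr)
        assume "\<not> ?thesis"
        then have "Poly_Mapping.lookup (a (Seg i)) u = 0"
          unfolding a_Seg by simp
        with u show False by (simp add: in_keys_iff Seg)
      qed
      then show ?thesis
        using off[of "Inner (Seg i) u"] q_inner by (force simp: points_G Seg)
    qed
  qed
  define R where "R = D - hinge_div G s a"
  have R: "Poly_Mapping.lookup R p = 0" if "p \<noteq> Vertex V2" for p
  proof (cases "p \<in> points G")
    case False
    then show ?thesis
      using off divisor_hinge_div[OF wf_G keys, of s]
      by (auto simp: R_def lookup_minus divisor_def in_keys_iff subset_iff)
  next
    case True
    have qv: "q j \<noteq> Vertex v" "q j \<noteq> Inner (Loop k) u" if "j \<le> n" for j v k u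
      using q_inner[OF that] by auto
    consider "p = Vertex V1" | i u where "p = Inner (Seg i) u" "i \<le> 2" | j u where "p = Inner (Loop j) u" "j \<le> n"
    proof (cases p)
      case (Vertex v)
      then show ?thesis
        using that(1) \<open>p \<noteq> Vertex V2\<close> by (cases v) auto
    next
      case (Inner e u)
      then show ?thesis
        using that(2,3) True by (cases e) (auto simp: points_G)
    qed
    then show ?thesis
    proof cases
      case 1
      have "(\<Sum>j\<in>{0..n}. (if q j = p then s (Loop j) else 0)
          - (if q j = p then s (Loop j) + total (a (Loop j)) else 0) + 0) = 0"
        by (rule sum.neutral) (use qv 1 in auto)
      then show ?thesis
        using s 1 unfolding R_def lookup_minus lookup_hinge_div sum_edges_G by simp
    next
      case (2 i u)
      have "(\<Sum>j\<in>{0..n}. (if q j = p then s (Loop j) else 0)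
          - (if q j = p then s (Loop j) + total (a (Loop j)) else 0) + 0) =
          - (\<Sum>j\<in>{0..n}. if q j = Inner (Seg i) u then total (a (Loop j)) else 0)"
        unfolding sum_negf[symmetric] by (rule sum.cong) (use 2 in auto)
      moreover have "i \<in> {0,1,2}" using 2 by auto
      ultimately show ?thesis
        using 2 unfolding R_def lookup_minus lookup_hinge_div sum_edges_G by (auto simp: a_Seg)
    next
      case (3 j u)
      have "(\<Sum>k\<in>{0..n}. (if q k = p then s (Loop k) else 0)
          - (if q k = p then s (Loop k) + total (a (Loop k)) else 0)
          + (if Loop j = Loop k then Poly_Mapping.lookup (a (Loop k)) u else 0)) =
          (\<Sum>k\<in>{0..n}. if k = j then Poly_Mapping.lookup (a (Loop j)) u else 0)"
        by (rule sum.cong) (use 3 qv in auto)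
      then show ?thesis
        using 3 unfolding R_def lookup_minus lookup_hinge_div sum_edges_G by (simp add: a_Loop)
    qed
  qed
  have "R = Poly_Mapping.single (Vertex V2) (Poly_Mapping.lookup R (Vertex V2))"
    by (rule poly_mapping_eqI) (auto simp: lookup_single when_def R)
  moreover have "div_degree R = 0"
    unfolding R_def using D(2) div_degree_hinge_div[of s a] by simp
  ultimately have "R = 0"
    by (metis div_degree_simps(3) single_zero)
  then show ?thesis
    using that[OF keys] by (simp add: R_def)
qed

text \<open>
  The conditions on \<open>D - D'\<close> are what is needed to choose slopes for which the values at the ends of
  the edges fit together: the value \<open>L\<close> at \<open>V2\<close> along each \<open>Seg i\<close>, and the value at \<open>q j\<close> at
  both ends of the loop \<open>j\<close>.
\<close>

lemma invariants_imp_lin_equiv: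
  assumes D: "divisor G (D - D')" "div_degree D = div_degree D'"
    "period l (\<lambda>i. weight (theta_moment i) (D - D'))"
    "\<And>j. j \<le> n \<Longrightarrow> weight (loop_moment j) (D - D') / c j \<in> \<int>"
  shows "lin_equiv G D D'"
proof -
  obtain s' L where s': "s' 0 + s' 1 + s' 2 = 0"
    "\<And>i. i \<le> 2 \<Longrightarrow> real_of_int (s' i) * l i + weight (theta_moment i) (D - D') = L"
    using D(3) by (auto simp: period_def)
  have "\<exists>m::int. weight (loop_moment j) (D - D') = of_int m * c j" if j: "j \<le> n" for j
    using D(4)[OF j] c_pos[OF j] by (auto elim!: Ints_cases simp: field_simps)
  then obtain m :: "nat \<Rightarrow> int" where m: "\<And>j. j \<le> n \<Longrightarrow> weight (loop_moment j) (D - D') = of_int (m j) * c j"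
    by metis
  define S where "S = Poly_Mapping.lookup (D - D') (Vertex V1)"
  \<comment> \<open>The moments count \<open>V1\<close> on \<open>Seg 0\<close>, so its multiplicity is added to the slope there;\<close>
  \<comment> \<open>\<open>m j\<close> is the final slope along the loop.\<close>
  define s where "s e = (case e of
      Seg i \<Rightarrow> if i = 0 then s' 0 + S else s' i
    | Loop j \<Rightarrow> m j - total (Poly_Mapping.map_key (Inner (Loop j)) (D - D')))" for e
  have S: "s (Seg 0) + s (Seg 1) + s (Seg 2) = S"
    using s'(1) by (simp add: s_def)
  obtain a where keys: "\<And>e. e \<in> edges G \<Longrightarrow> Poly_Mapping.keys (a e) \<subseteq> {0<..<len G e}"
    and Da: "D - D' = hinge_div G s a"
    using hinge_div_surj[of "D - D'" s] D S by (auto simp: S_def)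
  have tot: "s (Loop j) + total (a (Loop j)) = m j" if j: "j \<le> n" for j
  proof -
    have "a (Loop j) = Poly_Mapping.map_key (Inner (Loop j)) (D - D')"
    proof (rule poly_mapping_eqI)
      fix u
      have "Poly_Mapping.lookup (D - D') (Inner (Loop j) u) =
          (\<Sum>k\<in>{0..n}. (if q k = Inner (Loop j) u then s (Loop k) else 0)
          - (if q k = Inner (Loop j) u then s (Loop k) + total (a (Loop k)) else 0)
          + (if Loop j = Loop k then Poly_Mapping.lookup (a (Loop k)) u else 0))"
        unfolding Da lookup_hinge_div sum_edges_G by simp
      also have "\<dots> = (\<Sum>k\<in>{0..n}. if k = j then Poly_Mapping.lookup (a (Loop j)) u else 0)"
        by (rule sum.cong) (use q_inner in force)+
      also have "\<dots> = Poly_Mapping.lookup (a (Loop j)) u"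
        using j by simp
      finally show "Poly_Mapping.lookup (a (Loop j)) u =
          Poly_Mapping.lookup (Poly_Mapping.map_key (Inner (Loop j)) (D - D')) u"
        by (simp add: map_key.rep_eq[OF inj_Inner])
    qed
    then show ?thesis by (simp add: s_def)
  qed
  define g where "g p = (case p of
      Vertex V1 \<Rightarrow> 0 | Vertex V2 \<Rightarrow> L
    | Inner (Seg i) u \<Rightarrow> hinge 0 (s (Seg i)) (a (Seg i)) u | _ \<Rightarrow> 0)" for p :: "(vertex, edge) point"
  define k where "k e = (case e of Seg i \<Rightarrow> 0 | Loop j \<Rightarrow> g (q j))" for e
  define f where "f p = (case p of Inner (Loop j) u \<Rightarrow> hinge (k (Loop j)) (s (Loop j)) (a (Loop j)) u | _ \<Rightarrow> g p)" for p
  have "f (edge_map G e t) = hinge (k e) (s e) (a e) t" if e: "e \<in> edges G" and t: "t \<in> {0..len G e}" for e t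
  proof -
    have len: "0 < len G e" using wf_G e by (auto simp: wf_mgraph_def)
    have "f (src G e) = k e"
      using q_inner e by (cases e) (force simp: f_def k_def g_def)+
    then have 0: "f (src G e) = hinge (k e) (s e) (a e) 0"
      using hinge_0[OF keys[OF e], of "k e" "s e"] by simp
    have "f (tgt G e) = k e + of_int (s e) * len G e + weight (\<lambda>u. len G e - u) (a e)"
    proof (cases e)
      case (Seg i)
      then have i: "i \<le> 2" using e by simp
      have "weight (theta_moment i) (D - D') = of_int S * theta_moment i (Vertex V1) + weight (\<lambda>u. l i - u) (a (Seg i))"
        unfolding Da theta_moment_hinge_div[OF i] S ..
      then show ?thesis
        using s'(2)[OF i] by (auto simp: Seg f_def k_def g_def s_def algebra_simps)
    next
      case (Loop j)
      then have j: "j \<le> n" using e by simp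
      have "weight (\<lambda>u. u) (a (Loop j)) = of_int (m j) * c j"
        using m[OF j] unfolding Da loop_moment_hinge_div[OF j] .
      moreover have "f (q j) = g (q j)"
        using q_inner[OF j] by (auto simp: f_def)
      moreover have "real_of_int (s (Loop j)) * c j + real_of_int (total (a (Loop j))) * c j = real_of_int (m j) * c j"
        unfolding tot[OF j, symmetric] by (simp add: algebra_simps)
      ultimately show ?thesis
        by (simp add: Loop k_def weight_fun_diff weight_const)
    qed
    then have 1: "f (tgt G e) = hinge (k e) (s e) (a e) (len G e)"
      using hinge_end[OF keys[OF e], of "k e" "s e"] by simp
    consider "t = 0" | "t = len G e" | "0 < t" "t < len G e" using t by force
    then show ?thesis
    proof cases
      case 3
      then have "edge_map G e t = Inner e t" by (simp add: edge_map_def)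
      then show ?thesis by (cases e) (auto simp: f_def g_def k_def)
    qed (use 0 1 len in \<open>auto simp: edge_map_def\<close>)
  qed
  then show ?thesis
    unfolding lin_equiv_iff_hinges[OF wf_G] using keys Da by blast
qed

end


section \<open>Effective divisors\<close>

abbreviation pt :: "('v, 'e) point \<Rightarrow> ('v, 'e) graph_div" where
  "pt p \<equiv> Poly_Mapping.single p 1"

lemma divisor_simps [simp]:
  "divisor G D \<Longrightarrow> divisor G D' \<Longrightarrow> divisor G (D + D')"
  "divisor G D \<Longrightarrow> divisor G D' \<Longrightarrow> divisor G (D - D')"
  "p \<in> points G \<Longrightarrow> divisor G (Poly_Mapping.single p m)"
  "divisor G 0"
  using Poly_Mapping.keys_add[of D D'] Poly_Mapping.keys_add[of D "- D'"]
  by (auto simp: divisor_def)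

lemma effective_simps [simp]:
  "effective D \<Longrightarrow> effective D' \<Longrightarrow> effective (D + D')"
  "0 \<le> m \<Longrightarrow> effective (Poly_Mapping.single p m)"
  "effective 0"
  by (auto simp: effective_def lookup_add lookup_single when_def)

lemma effective_minus_pt:
  assumes "effective D" "p \<in> Poly_Mapping.keys D"
  shows "effective (D - pt p)"
proof -
  have "0 < Poly_Mapping.lookup D p"
    using assms by (metis effective_def in_keys_iff order_le_less)
  then show ?thesis
    using assms(1) by (auto simp: effective_def lookup_minus lookup_single when_def)
qed

lemma effective_degree_nonneg: "effective D \<Longrightarrow> 0 \<le> div_degree D"
  by (simp add: div_degree_def effective_def sum_nonneg)

lemma eff_divisors_0: "D \<in> eff_divisors G 0 \<longleftrightarrow> D = 0"
proof
  assume "D \<in> eff_divisors G 0"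
  then have D: "effective D" "div_degree D = 0"
    by (auto simp: eff_divisors_def)
  have "Poly_Mapping.keys D = {}"
  proof (rule ccontr)
    assume "Poly_Mapping.keys D \<noteq> {}"
    then obtain p where "p \<in> Poly_Mapping.keys D" by blast
    from effective_degree_nonneg[OF effective_minus_pt[OF D(1) this]] D(2) show False
      by simp
  qed
  then show "D = 0" by simp
qed (simp add: eff_divisors_def)

lemma eff_divisors_Suc:
  "D \<in> eff_divisors G (1 + int m) \<longleftrightarrow>
    (\<exists>p\<in>points G. \<exists>D'\<in>eff_divisors G (int m). D = pt p + D')"
proof
  assume "D \<in> eff_divisors G (1 + int m)"
  then have D: "divisor G D" "effective D" "div_degree D = 1 + int m"
    by (auto simp: eff_divisors_def)
  then have "D \<noteq> 0" by auto
  then obtain p where p: "p \<in> Poly_Mapping.keys D"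
    by (metis ex_in_conv keys_eq_empty)
  then have pG: "p \<in> points G" using D(1) by (auto simp: divisor_def)
  have "D - pt p \<in> eff_divisors G (int m)"
    using D pG effective_minus_pt[OF D(2) p] by (simp add: eff_divisors_def)
  then show "\<exists>p\<in>points G. \<exists>D'\<in>eff_divisors G (int m). D = pt p + D'"
    using pG by (intro bexI[of _ p] bexI[of _ "D - pt p"]) auto
qed (auto simp: eff_divisors_def)

lemma eff_divisors_1: "D \<in> eff_divisors G 1 \<longleftrightarrow> (\<exists>p\<in>points G. D = pt p)"
  using eff_divisors_Suc[of D G 0] by (simp add: eff_divisors_0)

lemma eff_divisors_2: "D \<in> eff_divisors G 2 \<longleftrightarrow> (\<exists>p\<in>points G. \<exists>r\<in>points G. D = pt p + pt r)"
  using eff_divisors_Suc[of D G 1] unfolding Bex_def by (auto simp: eff_divisors_1)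

lemma extract_pt:
  assumes "E \<in> eff_divisors G (1 + int m)" "p \<in> Poly_Mapping.keys E"
  obtains E' where "E' \<in> eff_divisors G (int m)" "E = pt p + E'"
    "\<And>r. r \<in> Poly_Mapping.keys E \<Longrightarrow> r \<noteq> p \<Longrightarrow> r \<in> Poly_Mapping.keys E'"
proof (rule that[of "E - pt p"])
  have "p \<in> points G"
    using assms by (auto simp: eff_divisors_def divisor_def)
  then show "E - pt p \<in> eff_divisors G (int m)"
    using assms by (simp add: eff_divisors_def effective_minus_pt)
  show "r \<in> Poly_Mapping.keys (E - pt p)" if "r \<in> Poly_Mapping.keys E" "r \<noteq> p" for r
    using that by (simp add: in_keys_iff lookup_minus lookup_single when_def)
qed simp

lemma two_points_in_degree_2:
  assumes "E \<in> eff_divisors G 2" "p \<in> Poly_Mapping.keys E" "r \<in> Poly_Mapping.keys E" "r \<noteq> p"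
  shows "E = pt p + pt r"
proof -
  have "E \<in> eff_divisors G (1 + int 1)" using assms(1) by simp
  from extract_pt[OF this assms(2)] obtain E' where E': "E' \<in> eff_divisors G (int 1)" "E = pt p + E'"
    and keys: "\<And>r. r \<in> Poly_Mapping.keys E \<Longrightarrow> r \<noteq> p \<Longrightarrow> r \<in> Poly_Mapping.keys E'"
    by metis
  from E'(1) obtain z where "E' = pt z" by (auto simp: eff_divisors_1)
  then show ?thesis using keys[OF assms(3,4)] E'(2) by simp
qed

text \<open>
  The last clause is for the case that a third point of the support is known.
\<close>

lemma two_points_in_degree_3:
  assumes "E \<in> eff_divisors G 3" "p \<in> Poly_Mapping.keys E" "r \<in> Poly_Mapping.keys E" "r \<noteq> p"
  obtains z where "z \<in> points G" "E = pt p + pt r + pt z"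
    "\<And>x. x \<in> Poly_Mapping.keys E \<Longrightarrow> x \<noteq> p \<Longrightarrow> x \<noteq> r \<Longrightarrow> x = z"
proof -
  have "E \<in> eff_divisors G (1 + int 2)" using assms(1) by simp
  from extract_pt[OF this assms(2)] obtain E' where E': "E' \<in> eff_divisors G (int 2)" "E = pt p + E'"
    and keys: "\<And>r. r \<in> Poly_Mapping.keys E \<Longrightarrow> r \<noteq> p \<Longrightarrow> r \<in> Poly_Mapping.keys E'"
    by metis
  have "E' \<in> eff_divisors G (1 + int 1)" using E'(1) by simp
  from extract_pt[OF this keys[OF assms(3,4)]] obtain E'' where E'': "E'' \<in> eff_divisors G (int 1)" "E' = pt r + E''"
    and keys': "\<And>x. x \<in> Poly_Mapping.keys E' \<Longrightarrow> x \<noteq> r \<Longrightarrow> x \<in> Poly_Mapping.keys E''"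
    by metis
  from E''(1) obtain z where z: "z \<in> points G" "E'' = pt z" by (auto simp: eff_divisors_1)
  show ?thesis
  proof (rule that[OF z(1)])
    show "E = pt p + pt r + pt z" using E'(2) E''(2) z(2) by (simp add: add.assoc)
    show "x = z" if "x \<in> Poly_Mapping.keys E" "x \<noteq> p" "x \<noteq> r" for x
      using keys'[OF keys[OF that(1,2)] that(3)] z(2) by simp
  qed
qed


section \<open>The equivalence relation and the rank\<close>

context theta_with_loops
begin

lemma lin_equiv_by_diff: "D - D' = E - E' \<Longrightarrow> lin_equiv G D D' \<Longrightarrow> lin_equiv G E E'"
  by (simp add: lin_equiv_def)

lemma lin_equiv_refl [simp]: "lin_equiv G D D"
  by (rule invariants_imp_lin_equiv) (auto intro: period_const)

lemma lin_equiv_add: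
  assumes "lin_equiv G A B" "lin_equiv G C D"
  shows "lin_equiv G (A + C) (B + D)"
proof (rule invariants_imp_lin_equiv)
  note 1 = lin_equiv_imp_invariants[OF assms(1)] and 2 = lin_equiv_imp_invariants[OF assms(2)]
  have eq: "A + C - (B + D) = (A - B) + (C - D)" by simp
  show "divisor G (A + C - (B + D))"
    unfolding eq using 1(1) 2(1) by simp
  show "div_degree (A + C) = div_degree (B + D)"
    using 1(2) 2(2) by simp
  show "period l (\<lambda>i. weight (theta_moment i) (A + C - (B + D)))"
    unfolding eq weight_add using 1(3) 2(3) by (rule period_add)
  show "weight (loop_moment j) (A + C - (B + D)) / c j \<in> \<int>" if "j \<le> n" for j
    unfolding eq weight_add add_divide_distrib using 1(4)[OF that] 2(4)[OF that] by (rule Ints_add)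
qed

lemma lin_equiv_sym:
  assumes "lin_equiv G A B"
  shows "lin_equiv G B A"
proof (rule invariants_imp_lin_equiv)
  note 1 = lin_equiv_imp_invariants[OF assms(1)]
  have eq: "B - A = - (A - B)" by simp
  show "divisor G (B - A)"
    unfolding eq using 1(1) by (simp only: divisor_def keys_minus)
  show "period l (\<lambda>i. weight (theta_moment i) (B - A))"
    unfolding eq weight_uminus using 1(3) by (rule period_minus)
  show "weight (loop_moment j) (B - A) / c j \<in> \<int>" if "j \<le> n" for j
    unfolding eq weight_uminus minus_divide_left[symmetric] using 1(4)[OF that] by (rule Ints_minus)
qed (use lin_equiv_imp_invariants(2)[OF assms] in simp)

lemma lin_equiv_trans [trans]:
  assumes "lin_equiv G A B" "lin_equiv G B C"
  shows "lin_equiv G A C"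
  by (rule lin_equiv_by_diff[OF _ lin_equiv_add[OF assms]]) simp

lemma vertex_in_points [simp]: "Vertex v \<in> points G"
  by (rule points_G)

text \<open>
  Degrees are invariant under linear equivalence, so the maximum in the definition of the rank is
  over a bounded set.
\<close>

lemma rank_bound:
  assumes "\<forall>F\<in>eff_divisors G (int r). lin_sys G (D - F) \<noteq> {}"
  shows "int r \<le> div_degree D"
proof -
  have "Poly_Mapping.single (Vertex V1) (int r) \<in> eff_divisors G (int r)"
    by (simp add: eff_divisors_def)
  then obtain E where E: "effective E" "lin_equiv G E (D - Poly_Mapping.single (Vertex V1) (int r))"
    using assms by (force simp: lin_sys_def)
  from lin_equiv_imp_invariants(2)[OF E(2)] effective_degree_nonneg[OF E(1)] show ?thesis
    by simp
qed

lemma rank_antimono: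
  assumes "\<forall>F\<in>eff_divisors G (int r). lin_sys G (D - F) \<noteq> {}" "r' \<le> r"
  shows "\<forall>F\<in>eff_divisors G (int r'). lin_sys G (D - F) \<noteq> {}"
proof
  fix F assume F: "F \<in> eff_divisors G (int r')"
  let ?S = "Poly_Mapping.single (Vertex V1) (int (r - r'))"
  have "F + ?S \<in> eff_divisors G (int r)"
    using F assms(2) by (simp add: eff_divisors_def)
  then obtain E where E: "divisor G E" "effective E" "lin_equiv G E (D - (F + ?S))"
    using assms(1) by (force simp: lin_sys_def)
  have "lin_equiv G (E + ?S) (D - F)"
    by (rule lin_equiv_by_diff[OF _ E(3)]) simp
  with E show "lin_sys G (D - F) \<noteq> {}"
    by (force simp: lin_sys_def)
qed

lemma div_rank_ge_iff:
  "int r \<le> div_rank G D \<longleftrightarrow> (\<forall>F\<in>eff_divisors G (int r). lin_sys G (D - F) \<noteq> {})"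
proof -
  let ?P = "\<lambda>r. \<forall>F\<in>eff_divisors G (int r). lin_sys G (D - F) \<noteq> {}"
  have bound: "\<forall>y. ?P y \<longrightarrow> y \<le> nat (div_degree D)"
    using rank_bound by fastforce
  have P0: "?P 0 \<longleftrightarrow> lin_sys G D \<noteq> {}"
    by (simp add: eff_divisors_0)
  show ?thesis
  proof
    assume r: "int r \<le> div_rank G D"
    then have ne: "lin_sys G D \<noteq> {}"
      by (auto simp: div_rank_def)
    with r have "r \<le> Greatest ?P"
      by (simp add: div_rank_def)
    moreover have "?P (Greatest ?P)"
      using P0 ne bound by (intro GreatestI_nat[where P = ?P and k = 0 and b = "nat (div_degree D)"]) blast+
    ultimately show "?P r"
      by (rule rank_antimono[rotated])
  next
    assume r: "?P r"
    then have "lin_sys G D \<noteq> {}"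
      using rank_antimono[OF r, of 0] P0 by blast
    moreover have "r \<le> Greatest ?P"
      using r bound by (intro Greatest_le_nat[where P = ?P and b = "nat (div_degree D)"]) blast+
    ultimately show "int r \<le> div_rank G D"
      by (simp add: div_rank_def)
  qed
qed


section \<open>Moving chips on the theta graph\<close>

abbreviation seg_pt :: "nat \<Rightarrow> real \<Rightarrow> (vertex, edge) point" where
  "seg_pt i t \<equiv> edge_map G (Seg i) t"

text \<open>
  Membership in the closed edge: both vertices lie on all three segments, which saves case
  distinctions when chips move onto a vertex.
\<close>

definition on_seg :: "nat \<Rightarrow> (vertex, edge) point \<Rightarrow> bool" where
  "on_seg i A \<longleftrightarrow> i \<le> 2 \<and> (\<exists>t. 0 \<le> t \<and> t \<le> l i \<and> A = seg_pt i t)"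

lemma seg_pt_ends [simp]: "seg_pt i 0 = Vertex V1" "i \<le> 2 \<Longrightarrow> seg_pt i (l i) = Vertex V2"
  using l_pos[of i] by (auto simp: edge_map_def)

lemma on_segI [intro]: "i \<le> 2 \<Longrightarrow> 0 \<le> t \<Longrightarrow> t \<le> l i \<Longrightarrow> on_seg i (seg_pt i t)"
  by (auto simp: on_seg_def)

lemma on_seg_Vertex [simp]: "i \<le> 2 \<Longrightarrow> on_seg i (Vertex v)"
  using on_segI[of i 0] on_segI[of i "l i"] l_pos[of i] by (cases v) auto

lemma on_seg_Inner: "i \<le> 2 \<Longrightarrow> 0 < t \<Longrightarrow> t < l i \<Longrightarrow> on_seg i (Inner (Seg i) t)"
  using on_segI[of i t] by (simp add: edge_map_def)

lemma on_seg_in_points: "on_seg i A \<Longrightarrow> A \<in> points G"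
  by (auto simp: on_seg_def edge_map_def points_G)

lemma on_seg_q: "j \<le> n \<Longrightarrow> \<exists>i. on_seg i (q j)"
  using q_inner[of j] on_seg_Inner by metis

lemma loop_moment_seg_pt [simp]: "loop_moment j (seg_pt i t) = 0"
  by (simp add: edge_map_def)

text \<open>
  Modulo periods every point of the closed edge \<open>i\<close> has moment \<open>l i - t\<close> on that edge, also \<open>V1\<close>,
  whose moment is by convention on \<open>Seg 0\<close>.
\<close>

lemma theta_moment_seg_pt:
  assumes "i \<le> 2" "0 \<le> t" "t \<le> l i"
  shows "period l (\<lambda>k. theta_moment k (seg_pt i t) - (if k = i then l i - t else 0))"
proof (cases "t = 0")
  case True
  have "period l (\<lambda>k. (if k = 0 then l 0 else 0) - (if k = i then l i else 0))"
    by (rule periodI[of "\<lambda>k. (if k = i then 1 else 0) - (if k = 0 then 1 else 0)" _ _ 0])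
      (use assms(1) in auto)
  then show ?thesis unfolding True seg_pt_ends(1) theta_moment_simps(1) diff_0_right .
next
  case False
  then have "theta_moment k (seg_pt i t) = (if k = i then l i - t else 0)" for k
    using assms by (auto simp: edge_map_def)
  then show ?thesis
    using period_const[of l 0] by simp
qed

text \<open>
  Two chips on one edge may move by the same distance in opposite directions, as this keeps their
  total moment.
\<close>

lemma move_pair:
  assumes "i \<le> 2" "0 \<le> a" "a \<le> l i" "0 \<le> b" "b \<le> l i" "0 \<le> a'" "a' \<le> l i" "0 \<le> b'" "b' \<le> l i"
    and "a + b = a' + b'"
  shows "lin_equiv G (pt (seg_pt i a) + pt (seg_pt i b)) (pt (seg_pt i a') + pt (seg_pt i b'))"
proof (rule invariants_imp_lin_equiv)
  let ?N = "\<lambda>t k. if k = i then l i - t else 0"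
  have "period l (\<lambda>k. ((theta_moment k (seg_pt i a) - ?N a k) + (theta_moment k (seg_pt i b) - ?N b k))
        - ((theta_moment k (seg_pt i a') - ?N a' k) + (theta_moment k (seg_pt i b') - ?N b' k)))"
    by (intro period_diff period_add theta_moment_seg_pt assms)
  then show "period l (\<lambda>k. weight (theta_moment k) (pt (seg_pt i a) + pt (seg_pt i b) - (pt (seg_pt i a') + pt (seg_pt i b'))))"
    by (rule period_shift[where d = 0]) (use assms(10) in auto)
  show "divisor G (pt (seg_pt i a) + pt (seg_pt i b) - (pt (seg_pt i a') + pt (seg_pt i b')))"
    using assms by (intro divisor_simps on_seg_in_points[of i] on_segI) auto
qed auto

text \<open>
  Firing across the cut between \<open>V1\<close> and \<open>V2\<close>: one chip on each edge, all moving by \<open>x\<close> in the same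
  direction. All three moments change by the same amount.
\<close>

lemma move_triple:
  assumes d: "i \<le> 2" "j \<le> 2" "k \<le> 2" "i \<noteq> j" "i \<noteq> k" "j \<noteq> k"
    and "0 \<le> a" "a \<le> l i" "0 \<le> b" "b \<le> l j" "0 \<le> e" "e \<le> l k"
    and "0 \<le> a + x" "a + x \<le> l i" "0 \<le> b + x" "b + x \<le> l j" "0 \<le> e + x" "e + x \<le> l k"
  shows "lin_equiv G (pt (seg_pt i a) + pt (seg_pt j b) + pt (seg_pt k e))
     (pt (seg_pt i (a + x)) + pt (seg_pt j (b + x)) + pt (seg_pt k (e + x)))" (is "lin_equiv G ?D ?D'")
proof (rule invariants_imp_lin_equiv)
  let ?N = "\<lambda>i t k. if k = i then l i - t else 0"
  have "period l (\<lambda>m. ((theta_moment m (seg_pt i a) - ?N i a m) + (theta_moment m (seg_pt j b) - ?N j b m) + (theta_moment m (seg_pt k e) - ?N k e m))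
        - ((theta_moment m (seg_pt i (a + x)) - ?N i (a + x) m) + (theta_moment m (seg_pt j (b + x)) - ?N j (b + x) m)
          + (theta_moment m (seg_pt k (e + x)) - ?N k (e + x) m)))"
    by (intro period_diff period_add theta_moment_seg_pt assms)
  moreover have "m = i \<or> m = j \<or> m = k" if "m \<le> 2" for m
    using that d by arith
  ultimately show "period l (\<lambda>m. weight (theta_moment m) (?D - ?D'))"
    by (elim period_shift[where d = x]) (use d in auto)
  show "divisor G (?D - ?D')"
    using assms by (intro divisor_simps) (auto intro!: on_seg_in_points on_segI)
qed auto

lemma loop_conjugate:
  assumes "j \<le> n" "0 < t" "t < c j"
  shows "lin_equiv G (pt (Inner (Loop j) t) + pt (Inner (Loop j) (c j - t))) (pt (q j) + pt (q j))"
proof (rule invariants_imp_lin_equiv)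
  show "divisor G (pt (Inner (Loop j) t) + pt (Inner (Loop j) (c j - t)) - (pt (q j) + pt (q j)))"
    using assms on_seg_q[of j] on_seg_in_points by (intro divisor_simps) (auto simp: points_G)
qed (use assms in \<open>auto intro: period_const\<close>)

lemma theta_conjugate:
  assumes "on_seg i A"
  obtains A' where "on_seg i A'" "lin_equiv G (pt A + pt A') (pt (Vertex V1) + pt (Vertex V2))"
proof -
  obtain t where t: "i \<le> 2" "0 \<le> t" "t \<le> l i" "A = seg_pt i t"
    using assms by (auto simp: on_seg_def)
  have "lin_equiv G (pt (seg_pt i t) + pt (seg_pt i (l i - t))) (pt (seg_pt i 0) + pt (seg_pt i (l i)))"
    using t by (intro move_pair) auto
  then show ?thesis
    using that[of "seg_pt i (l i - t)", OF on_segI] t by simp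
qed

text \<open>
  Move the two chips apart until one of them reaches an end of the edge.
\<close>

lemma pair_to_vertex:
  assumes "on_seg i A" "on_seg i B"
  obtains v C where "on_seg i C" "lin_equiv G (pt A + pt B) (pt (Vertex v) + pt C)"
proof -
  obtain a b where ab: "i \<le> 2" "0 \<le> a" "a \<le> l i" "A = seg_pt i a" "0 \<le> b" "b \<le> l i" "B = seg_pt i b"
    using assms by (auto simp: on_seg_def)
  show ?thesis
  proof (cases "a + b \<le> l i")
    case True
    have "lin_equiv G (pt (seg_pt i a) + pt (seg_pt i b)) (pt (seg_pt i 0) + pt (seg_pt i (a + b)))"
      using ab True by (intro move_pair) auto
    then show ?thesis
      using that[of "seg_pt i (a + b)" V1, OF on_segI] ab True by simp
  next
    case False
    have "lin_equiv G (pt (seg_pt i a) + pt (seg_pt i b)) (pt (seg_pt i (l i)) + pt (seg_pt i (a + b - l i)))"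
      using ab False by (intro move_pair) auto
    then show ?thesis
      using that[of "seg_pt i (a + b - l i)" V2, OF on_segI] ab False by simp
  qed
qed

text \<open>
  \<open>V1 + V2\<close> is the canonical divisor \<open>K\<close> of the theta graph.
\<close>

definition contains_K :: "(vertex, edge) graph_div \<Rightarrow> bool" where
  "contains_K D \<longleftrightarrow> (\<exists>i j A B. on_seg i A \<and> on_seg j B \<and>
     lin_equiv G D (pt (Vertex V1) + pt (Vertex V2) + pt A + pt B))"

lemma contains_KI:
  assumes "lin_equiv G D (pt (Vertex v) + pt (Vertex v') + pt A + pt B)" "v \<noteq> v'" "on_seg i A" "on_seg j B"
  shows "contains_K D"
proof -
  have "pt (Vertex v) + pt (Vertex v') = pt (Vertex V1) + pt (Vertex V2)"
    using assms(2) by (cases v; cases v') (simp_all add: add.commute)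
  then show ?thesis
    unfolding contains_K_def using assms by metis
qed

lemma contains_K_cong: "lin_equiv G D D' \<Longrightarrow> contains_K D' \<Longrightarrow> contains_K D"
  unfolding contains_K_def using lin_equiv_trans by blast

text \<open>
  With one chip on each edge, firing from the vertex \<open>v\<close> brings a chip to the other vertex while the
  one at \<open>v\<close> stays.
\<close>

lemma contains_K_vertex_triple:
  assumes on: "on_seg i A" "on_seg j B" "on_seg k C" and d: "i \<noteq> j" "i \<noteq> k" "j \<noteq> k"
  shows "contains_K (pt (Vertex v) + (pt A + pt B + pt C))"
proof -
  obtain a b e where
    ab: "i \<le> 2" "0 \<le> a" "a \<le> l i" "A = seg_pt i a" "j \<le> 2" "0 \<le> b" "b \<le> l j" "B = seg_pt j b"
      "k \<le> 2" "0 \<le> e" "e \<le> l k" "C = seg_pt k e"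
    using on by (auto simp: on_seg_def)
  \<comment> \<open>The distance after which the first chip arrives at the other vertex, with sign.\<close>
  define x where "x = (case v of V1 \<Rightarrow> min (l i - a) (min (l j - b) (l k - e)) | V2 \<Rightarrow> - min a (min b e))"
  have bounds: "0 \<le> a + x" "a + x \<le> l i" "0 \<le> b + x" "b + x \<le> l j" "0 \<le> e + x" "e + x \<le> l k"
    using ab by (auto simp: x_def split: vertex.splits)
  have on': "on_seg i (seg_pt i (a + x))" "on_seg j (seg_pt j (b + x))" "on_seg k (seg_pt k (e + x))"
    using ab bounds by auto
  have move: "lin_equiv G (pt (Vertex v) + (pt A + pt B + pt C))
      (pt (Vertex v) + (pt (seg_pt i (a + x)) + pt (seg_pt j (b + x)) + pt (seg_pt k (e + x))))"
    unfolding ab by (intro lin_equiv_add lin_equiv_refl move_triple ab d bounds)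
  obtain v' where v': "v \<noteq> v'" by (metis vertex.distinct(1))
  have "seg_pt i (a + x) = Vertex v' \<or> seg_pt j (b + x) = Vertex v' \<or> seg_pt k (e + x) = Vertex v'"
  proof (cases v)
    case V1
    then have "v' = V2" using v' by (cases v') auto
    moreover have "a + x = l i \<or> b + x = l j \<or> e + x = l k"
      using V1 by (auto simp: x_def min_def)
    ultimately show ?thesis using ab by auto
  next
    case V2
    then have "v' = V1" using v' by (cases v') auto
    moreover have "a + x = 0 \<or> b + x = 0 \<or> e + x = 0"
      using V2 by (auto simp: x_def min_def)
    ultimately show ?thesis using ab by auto
  qed
  then show ?thesis
  proof (elim disjE)
    assume "seg_pt i (a + x) = Vertex v'"
    with move v' show ?thesis
      by (intro contains_KI[OF _ v' on'(2,3)]) (simp add: add_ac)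
  next
    assume "seg_pt j (b + x) = Vertex v'"
    with move v' show ?thesis
      by (intro contains_KI[OF _ v' on'(1,3)]) (simp add: add_ac)
  next
    assume "seg_pt k (e + x) = Vertex v'"
    with move v' show ?thesis
      by (intro contains_KI[OF _ v' on'(1,2)]) (simp add: add_ac)
  qed
qed

lemma third_index:
  assumes "i \<le> 2" "j \<le> 2"
  obtains k :: nat where "k \<le> 2" "k \<noteq> i" "k \<noteq> j"
proof -
  have "\<exists>k\<le>2. k \<noteq> i \<and> k \<noteq> j"
    using assms by presburger
  with that show ?thesis by blast
qed

text \<open>
  Chips at \<open>v\<close> may be regarded as lying on any edge. If the edges of \<open>A\<close> and \<open>B\<close> differ, one of the
  two chips at \<open>v\<close> serves for the third edge; otherwise the pair first spreads, which puts a chip on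
  the other vertex or a third one on \<open>v\<close>.
\<close>

lemma contains_K_two_vertices:
  assumes "on_seg i A" "on_seg j B"
  shows "contains_K (pt (Vertex v) + pt (Vertex v) + pt A + pt B)"
proof (cases "i = j")
  case False
  obtain k where k: "k \<le> 2" "k \<noteq> i" "k \<noteq> j"
    using third_index[of i j] assms by (auto simp: on_seg_def)
  then show ?thesis
    using contains_K_vertex_triple[OF on_seg_Vertex[OF k(1)] assms] False by (simp add: add.assoc)
next
  case True
  then have B: "on_seg i B" using assms(2) by simp
  obtain v' C where C: "on_seg i C" and eq: "lin_equiv G (pt A + pt B) (pt (Vertex v') + pt C)"
    using pair_to_vertex[OF assms(1) B] .
  have eq': "lin_equiv G (pt (Vertex v) + pt (Vertex v) + pt A + pt B)
      (pt (Vertex v) + pt (Vertex v) + pt (Vertex v') + pt C)"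
    using lin_equiv_add[OF lin_equiv_refl[of "pt (Vertex v) + pt (Vertex v)"] eq] by (simp add: add_ac)
  show ?thesis
  proof (cases "v = v'")
    case False
    have "on_seg 0 (Vertex v)" by simp
    from contains_KI[OF _ False this C] eq' show ?thesis by (simp add: add_ac)
  next
    case True
    have i: "i \<le> 2" using C by (auto simp: on_seg_def)
    obtain j where j: "j \<le> 2" "j \<noteq> i"
      using third_index[of i i] i by auto
    obtain k where k: "k \<le> 2" "k \<noteq> i" "k \<noteq> j"
      using third_index[of i j] i j by auto
    have "contains_K (pt (Vertex v) + (pt (Vertex v) + pt (Vertex v) + pt C))"
      using j k by (intro contains_K_vertex_triple[of j _ k _ i] C) auto
    with contains_K_cong[OF eq'] True show ?thesis by (simp add: add_ac)
  qed
qed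

lemma contains_K_vertex_pair:
  assumes "on_seg i A" "on_seg i B" "on_seg k C"
  shows "contains_K (pt (Vertex v) + pt A + pt B + pt C)"
proof -
  obtain v' D where D: "on_seg i D" and eq: "lin_equiv G (pt A + pt B) (pt (Vertex v') + pt D)"
    using pair_to_vertex[OF assms(1,2)] .
  have eq': "lin_equiv G (pt (Vertex v) + pt A + pt B + pt C)
      (pt (Vertex v) + pt (Vertex v') + pt D + pt C)"
    using lin_equiv_add[OF lin_equiv_refl[of "pt (Vertex v) + pt C"] eq] by (simp add: add_ac)
  show ?thesis
  proof (cases "v = v'")
    case False
    from contains_KI[OF eq' False D assms(3)] show ?thesis .
  next
    case True
    then show ?thesis
      using contains_K_cong[OF eq'] contains_K_two_vertices[OF D assms(3)] by simp
  qed
qed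

lemma contains_K_vertex:
  assumes "on_seg i A" "on_seg j B" "on_seg k C"
  shows "contains_K (pt (Vertex v) + pt A + pt B + pt C)"
proof -
  consider "i = j" | "i = k" | "j = k" | "i \<noteq> j" "i \<noteq> k" "j \<noteq> k" by blast
  then show ?thesis
  proof cases
    case 1
    then show ?thesis using contains_K_vertex_pair assms by blast
  next
    case 2
    then show ?thesis using contains_K_vertex_pair[of i A C j B v] assms by (simp add: add_ac)
  next
    case 3
    then show ?thesis using contains_K_vertex_pair[of j B C i A v] assms by (simp add: add_ac)
  next
    case 4
    then show ?thesis using contains_K_vertex_triple[OF assms, of v] by (simp add: add.assoc)
  qed
qed

lemma contains_K_pair:
  assumes "on_seg i A" "on_seg i B" "on_seg j C" "on_seg k D"
  shows "contains_K (pt A + pt B + (pt C + pt D))"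
proof -
  obtain v E where E: "on_seg i E" and eq: "lin_equiv G (pt A + pt B) (pt (Vertex v) + pt E)"
    using pair_to_vertex[OF assms(1,2)] .
  show ?thesis
    using contains_K_cong[OF lin_equiv_add[OF eq lin_equiv_refl]] contains_K_vertex[OF E assms(3,4)]
    by (simp add: add.assoc)
qed

text \<open>
  Two of the four chips share an edge, so a chip can be moved to a vertex.
\<close>

lemma contains_K_degree_4:
  assumes "on_seg i A" "on_seg j B" "on_seg k C" "on_seg m D"
  shows "contains_K (pt A + pt B + pt C + pt D)"
proof -
  have "i \<le> 2" "j \<le> 2" "k \<le> 2" "m \<le> 2"
    using assms by (auto simp: on_seg_def)
  then consider "i = j" | "i = k" | "i = m" | "j = k" | "j = m" | "k = m"
    by linarith
  then show ?thesis
  proof cases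
    case 1
    then show ?thesis using contains_K_pair[of i A B k C m D] assms by (simp add: add_ac)
  next
    case 2
    then show ?thesis using contains_K_pair[of i A C j B m D] assms by (simp add: add_ac)
  next
    case 3
    then show ?thesis using contains_K_pair[of i A D j B k C] assms by (simp add: add_ac)
  next
    case 4
    then show ?thesis using contains_K_pair[of j B C i A m D] assms by (simp add: add_ac)
  next
    case 5
    then show ?thesis using contains_K_pair[of j B D i A k C] assms by (simp add: add_ac)
  next
    case 6
    then show ?thesis using contains_K_pair[of k C D i A j B] assms by (simp add: add_ac)
  qed
qed

text \<open>
  Write \<open>D\<close> for the given divisor and \<open>x'\<close> for the mirror image of \<open>x\<close>, so that \<open>x + x' \<sim> K\<close>. From
  \<open>D \<sim> K + Y + Z\<close> one gets \<open>D - 2 * x \<sim> 2 * x' + Y + Z - K\<close>, and \<open>2 * x' + Y + Z\<close> is again an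
  effective divisor of degree 4, hence equivalent to one that contains \<open>K\<close>.
\<close>

lemma degree_4_contains_double:
  assumes E: "on_seg i A" "on_seg j B" "on_seg k C" "on_seg m D" and x: "on_seg i' x"
  obtains i'' j'' Y Z where "on_seg i'' Y" "on_seg j'' Z"
    "lin_equiv G (pt A + pt B + pt C + pt D) (pt x + pt x + pt Y + pt Z)"
proof -
  obtain x' where x': "on_seg i' x'" and xx': "lin_equiv G (pt x + pt x') (pt (Vertex V1) + pt (Vertex V2))"
    using theta_conjugate[OF x] .
  obtain a b Y Z where YZ: "on_seg a Y" "on_seg b Z"
    and 1: "lin_equiv G (pt A + pt B + pt C + pt D) (pt (Vertex V1) + pt (Vertex V2) + pt Y + pt Z)"
    using contains_K_degree_4[OF E] unfolding contains_K_def by blast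
  obtain a' b' Y' Z' where YZ': "on_seg a' Y'" "on_seg b' Z'"
    and 2: "lin_equiv G (pt x' + pt x' + pt Y + pt Z) (pt (Vertex V1) + pt (Vertex V2) + pt Y' + pt Z')"
    using contains_K_degree_4[OF x' x' YZ] unfolding contains_K_def by blast
  have "lin_equiv G (pt A + pt B + pt C + pt D) (pt x + pt x + pt Y' + pt Z')"
    by (rule lin_equiv_by_diff[OF _ lin_equiv_add[OF lin_equiv_add[OF 1 2]
          lin_equiv_add[OF lin_equiv_sym[OF xx'] lin_equiv_sym[OF xx']]]]) simp
  with YZ' that show ?thesis by blast
qed

text \<open>
  A point inside a loop is paired with its mirror image there, a point of the theta graph with itself.
\<close>

lemma conjugate_pair:
  assumes "x \<in> points G"
  obtains x' i y where "x' \<in> points G" "on_seg i y" "lin_equiv G (pt x + pt x') (pt y + pt y)"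
proof -
  consider v where "x = Vertex v" | i u where "x = Inner (Seg i) u" | j u where "x = Inner (Loop j) u"
    by (metis point.exhaust edge.exhaust)
  then show thesis
  proof cases
    case 1
    then show thesis using that[of x 0 x] by simp
  next
    case (2 i u)
    then show thesis using that[of x i x] assms by (auto simp: points_G intro: on_seg_Inner)
  next
    case (3 j u)
    then have u: "j \<le> n" "0 < u" "u < c j" using assms by (auto simp: points_G)
    then obtain i where "on_seg i (q j)" using on_seg_q by blast
    then show thesis
      using that[of "Inner (Loop j) (c j - u)" i "q j"] loop_conjugate[OF u] u 3 by (simp add: points_G)
  qed
qed

lemma rank_ge_1:
  assumes E: "lin_equiv G E (pt A + pt B + pt C + pt D)"
    and on: "on_seg i A" "on_seg j B" "on_seg k C" "on_seg m D"
  shows "1 \<le> div_rank G E"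
proof -
  have "lin_sys G (E - pt x) \<noteq> {}" if x: "x \<in> points G" for x
  proof -
    obtain x' i' y where x': "x' \<in> points G" "on_seg i' y" "lin_equiv G (pt x + pt x') (pt y + pt y)"
      using conjugate_pair[OF x] .
    obtain a b Y Z where YZ: "on_seg a Y" "on_seg b Z"
      and 1: "lin_equiv G (pt A + pt B + pt C + pt D) (pt y + pt y + pt Y + pt Z)"
      using degree_4_contains_double[OF on x'(2)] .
    have "lin_equiv G (pt x' + pt Y + pt Z) (E - pt x)"
      by (rule lin_equiv_by_diff[OF _ lin_equiv_add[OF lin_equiv_sym[OF lin_equiv_trans[OF E 1]] x'(3)]])
        simp
    moreover have "divisor G (pt x' + pt Y + pt Z)" "effective (pt x' + pt Y + pt Z)"
      using x'(1) on_seg_in_points[OF YZ(1)] on_seg_in_points[OF YZ(2)] by simp_all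
    ultimately show ?thesis
      unfolding lin_sys_def by blast
  qed
  then show ?thesis
    using div_rank_ge_iff[of 1 E] by (auto simp: eff_divisors_1)
qed

end


section \<open>Rigidity on the theta graph\<close>

text \<open>
  The moments that occur below are smaller than twice the length of the edge, so it suffices to
  tell apart these five kinds of slopes. Products \<open>s * l\<close> can then be treated as atoms.
\<close>

lemma int_multiple_cases:
  fixes s :: int and l :: real
  assumes "0 < l"
  shows "s \<le> -2 \<and> of_int s * l \<le> -2 * l \<or> s = -1 \<and> of_int s * l = - l \<or> s = 0 \<and> of_int s * l = 0
    \<or> s = 1 \<and> of_int s * l = l \<or> 2 \<le> s \<and> 2 * l \<le> of_int s * l"
proof -
  consider "s \<le> -2" | "s = -1" | "s = 0" | "s = 1" | "2 \<le> s" by linarith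
  then show ?thesis
  proof cases
    case 1
    then have "of_int s * l \<le> -2 * l" using assms by (intro mult_right_mono) auto
    with 1 show ?thesis by simp
  next
    case 5
    then have "2 * l \<le> of_int s * l" using assms by (intro mult_right_mono) auto
    with 5 show ?thesis by simp
  qed auto
qed

lemma period_cases:
  assumes "period l x" "\<And>i. i \<le> 2 \<Longrightarrow> 0 < l i"
  obtains s0 s1 s2 :: int and L where "s0 + s1 + s2 = 0"
    "of_int s0 * l 0 + x 0 = L" "of_int s1 * l 1 + x 1 = L" "of_int s2 * l 2 + x 2 = L"
proof -
  obtain s :: "nat \<Rightarrow> int" and L where "s 0 + s 1 + s 2 = 0" "\<And>i. i \<le> 2 \<Longrightarrow> of_int (s i) * l i + x i = L"
    using assms(1) by (auto simp: period_def)
  then show ?thesis using that[of "s 0" "s 1" "s 2" L] by simp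
qed

text \<open>
  Let \<open>L\<close> be the common value. If \<open>L > 0\<close>, the three equations bound the integers \<open>s i\<close> from below
  so strongly that their sum is positive; if \<open>L < 0\<close>, the sum is negative. If \<open>L = 0\<close>, one of the
  edges \<open>1\<close> and \<open>2\<close> has a moment that is not a multiple of its length. The index \<open>k\<close> tells on which
  edge the arbitrary point lies.
\<close>

lemma not_period_double:
  assumes l: "\<And>i. i \<le> 2 \<Longrightarrow> 0 < l i"
    and k: "k \<le> 2" "0 \<le> t" "t \<le> l k" and x: "0 < x" "x < l 1" and y: "l 2 / 2 < y" "y < l 2"
  shows "\<not> period l (\<lambda>i. (if i = k then l k - t else 0) + (if i = 1 then l 1 - x else 0)
      - 2 * (if i = 2 then l 2 - y else 0))"
proof
  assume "period l (\<lambda>i. (if i = k then l k - t else 0) + (if i = 1 then l 1 - x else 0)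
      - 2 * (if i = 2 then l 2 - y else 0))"
  then obtain s0 s1 s2 :: int and L where s: "s0 + s1 + s2 = 0"
    "of_int s0 * l 0 + (if 0 = k then l k - t else 0) = L"
    "of_int s1 * l 1 + ((if 1 = k then l k - t else 0) + (l 1 - x)) = L"
    "of_int s2 * l 2 + ((if 2 = k then l k - t else 0) - 2 * (l 2 - y)) = L"
    by (rule period_cases[OF _ l]) auto
  note c = int_multiple_cases[OF l[of 0], of s0] int_multiple_cases[OF l[of 1], of s1]
    int_multiple_cases[OF l[of 2], of s2]
  define p0 p1 p2 where p: "p0 = of_int s0 * l 0" "p1 = of_int s1 * l 1" "p2 = of_int s2 * l 2"
  have l': "0 < l 0" "0 < l 1" "0 < l 2" using l by auto
  note s = s[folded p] and c = c[folded p, simplified]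
  consider "k = 0" | "k = 1" | "k = 2" using k by linarith
  then show False
  proof cases
    case 1
    with k x y l' s c show ?thesis by simp (smt (z3))
  next
    case 2
    with k x y l' s c show ?thesis by simp (smt (z3))
  next
    case 3
    with k x y l' s c show ?thesis by simp (smt (z3))
  qed
qed

text \<open>
  The same trichotomy for the sign of the common value; the two given chips on edge \<open>2\<close> together
  have moment \<open>y' - y\<close>, which is nonzero and smaller than \<open>l 2\<close> in absolute value.
\<close>

lemma not_period_pair:
  assumes l: "\<And>i. i \<le> 2 \<Longrightarrow> 0 < l i"
    and k: "k \<le> 2" "0 \<le> t" "t \<le> l k" and x: "0 < x" "x < l 1"
    and y: "0 < y" "y < l 2" "0 < y'" "y' < l 2" "y \<noteq> y'"
  shows "\<not> period l (\<lambda>i. (if i = k then l k - t else 0) + (if i = 2 then l 2 - y else 0)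
      - ((if i = 1 then l 1 - x else 0) + (if i = 2 then l 2 - y' else 0)))"
proof
  assume "period l (\<lambda>i. (if i = k then l k - t else 0) + (if i = 2 then l 2 - y else 0)
      - ((if i = 1 then l 1 - x else 0) + (if i = 2 then l 2 - y' else 0)))"
  then obtain s0 s1 s2 :: int and L where s: "s0 + s1 + s2 = 0"
    "of_int s0 * l 0 + (if 0 = k then l k - t else 0) = L"
    "of_int s1 * l 1 + ((if 1 = k then l k - t else 0) - (l 1 - x)) = L"
    "of_int s2 * l 2 + ((if 2 = k then l k - t else 0) + (l 2 - y) - (l 2 - y')) = L"
    by (rule period_cases[OF _ l]) auto
  note c = int_multiple_cases[OF l[of 0], of s0] int_multiple_cases[OF l[of 1], of s1]
    int_multiple_cases[OF l[of 2], of s2]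
  define p0 p1 p2 where p: "p0 = of_int s0 * l 0" "p1 = of_int s1 * l 1" "p2 = of_int s2 * l 2"
  have l': "0 < l 0" "0 < l 1" "0 < l 2" using l by auto
  note s = s[folded p] and c = c[folded p, simplified]
  consider "k = 0" | "k = 1" | "k = 2" using k by linarith
  then show False
  proof cases
    case 1
    with k x y l' s c show ?thesis by simp (smt (z3))
  next
    case 2
    with k x y l' s c show ?thesis by simp (smt (z3))
  next
    case 3
    with k x y l' s c show ?thesis by simp (smt (z3))
  qed
qed


lemma fraction_notin_Ints:
  fixes x c :: real
  assumes "x \<noteq> 0" "\<bar>x\<bar> < c"
  shows "x / c \<notin> \<int>"
proof
  assume "x / c \<in> \<int>"
  moreover have "x / c \<noteq> 0" "\<bar>x / c\<bar> < 1"
    using assms by (auto simp: abs_divide)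
  ultimately show False
    using Ints_nonzero_abs_less1 by blast
qed

context theta_with_loops
begin

text \<open>
  In the rigidity statements the arbitrary point may lie anywhere, also inside a loop, where it has
  the moments of the point of attachment.
\<close>

lemma theta_moment_of_point:
  assumes "T \<in> points G"
  obtains k t where "k \<le> 2" "0 \<le> t" "t \<le> l k"
    "period l (\<lambda>i. theta_moment i T - (if i = k then l k - t else 0))"
proof -
  have "\<exists>i A. on_seg i A \<and> (\<forall>m. theta_moment m T = theta_moment m A)"
  proof (cases T)
    case (Vertex v)
    then show ?thesis using on_seg_Vertex[of 0 v] by blast
  next
    case (Inner e u)
    show ?thesis
    proof (cases e)
      case (Seg i)
      then have "on_seg i T" using Inner assms on_seg_Inner[of i u] by (simp add: points_G)
      then show ?thesis by blast
    next
      case (Loop j)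
      then have j: "j \<le> n" using Inner assms by (simp add: points_G)
      from on_seg_q[OF j] j show ?thesis by (auto simp: Inner Loop)
    qed
  qed
  then obtain i A where A: "on_seg i A" "\<And>m. theta_moment m T = theta_moment m A" by blast
  then obtain t where "i \<le> 2" "0 \<le> t" "t \<le> l i" "A = seg_pt i t" by (auto simp: on_seg_def)
  then show ?thesis
    using that[of i t] theta_moment_seg_pt[of i t] A(2) by simp
qed

text \<open>
  On every edge \<open>i\<close> a point and its mirror image have total moment \<open>l i\<close>; hence all such pairs
  are equivalent to each other.
\<close>

lemma period_edge_lengths:
  assumes "i \<le> 2" "j \<le> 2"
  shows "period l (\<lambda>k. (if k = i then l i else 0) - (if k = j then l j else 0))"
  by (rule periodI[of "\<lambda>k. (if k = j then 1 else 0) - (if k = i then 1 else 0)" _ _ 0])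
    (use assms in auto)

lemma double_rigid:
  assumes T: "T \<in> points G" and x: "0 < x" "x < l 1" and y: "l 2 / 2 < y" "y < l 2"
  shows "\<not> period l (\<lambda>i. theta_moment i T + theta_moment i (Inner (Seg 1) x) - 2 * theta_moment i (Inner (Seg 2) y))"
proof
  assume *: "period l (\<lambda>i. theta_moment i T + theta_moment i (Inner (Seg 1) x) - 2 * theta_moment i (Inner (Seg 2) y))"
  obtain k t where k: "k \<le> 2" "0 \<le> t" "t \<le> l k"
    and per: "period l (\<lambda>i. theta_moment i T - (if i = k then l k - t else 0))"
    using theta_moment_of_point[OF T] .
  show False
    using not_period_double[OF l_pos k x y] period_shift[OF period_diff[OF * per], where d = 0]
    by simp
qed

lemma pair_rigid:
  assumes T: "T \<in> points G" and x: "0 < x" "x < l 1"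
    and y: "0 < y" "y < l 2" "0 < y'" "y' < l 2" "y \<noteq> y'"
  shows "\<not> period l (\<lambda>i. theta_moment i T + theta_moment i (Inner (Seg 2) y)
     - (theta_moment i (Inner (Seg 1) x) + theta_moment i (Inner (Seg 2) y')))"
proof
  assume *: "period l (\<lambda>i. theta_moment i T + theta_moment i (Inner (Seg 2) y)
     - (theta_moment i (Inner (Seg 1) x) + theta_moment i (Inner (Seg 2) y')))"
  obtain k t where k: "k \<le> 2" "0 \<le> t" "t \<le> l k"
    and per: "period l (\<lambda>i. theta_moment i T - (if i = k then l k - t else 0))"
    using theta_moment_of_point[OF T] .
  show False
    using not_period_pair[OF l_pos k x y] period_shift[OF period_diff[OF * per], where d = 0]
    by simp
qed


section \<open>Divisors of rank one\<close>

text \<open>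
  A divisor without chips inside the loop \<open>j\<close> has loop moment zero.
\<close>

lemma chip_on_loop:
  assumes "lin_equiv G E D" "j \<le> n" "weight (loop_moment j) D / c j \<notin> \<int>"
  obtains u where "Inner (Loop j) u \<in> Poly_Mapping.keys E"
proof (rule ccontr)
  assume none: "\<not> thesis"
  have "weight (loop_moment j) E = weight (\<lambda>_. 0) E"
  proof (rule weight_cong)
    fix p assume "p \<in> Poly_Mapping.keys E"
    then show "loop_moment j p = 0"
      using that none by (auto simp: loop_moment_def split: point.splits edge.splits)
  qed
  then have "weight (loop_moment j) (E - D) / c j = - (weight (loop_moment j) D / c j)"
    by (simp add: weight_const)
  then show False
    using lin_equiv_imp_invariants(4)[OF assms(1,2)] assms(3) by (metis Ints_minus minus_minus)
qed

lemma rank_1_divisor_through_two_points: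
  assumes "F \<in> eff_divisors G 2"
  shows "\<exists>E\<in>eff_divisors G 4. 1 \<le> div_rank G E \<and> effective (E - F)"
proof -
  obtain a b where ab: "a \<in> points G" "b \<in> points G" "F = pt a + pt b"
    using assms by (auto simp: eff_divisors_2)
  obtain a' i A where a': "a' \<in> points G" "on_seg i A" "lin_equiv G (pt a + pt a') (pt A + pt A)"
    using conjugate_pair[OF ab(1)] .
  obtain b' j B where b': "b' \<in> points G" "on_seg j B" "lin_equiv G (pt b + pt b') (pt B + pt B)"
    using conjugate_pair[OF ab(2)] .
  let ?E = "pt a + pt a' + (pt b + pt b')"
  have "lin_equiv G ?E (pt A + pt A + pt B + pt B)"
    using lin_equiv_add[OF a'(3) b'(3)] by (simp add: add.assoc)
  then have "1 \<le> div_rank G ?E"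
    by (rule rank_ge_1[OF _ a'(2) a'(2) b'(2) b'(2)])
  moreover have "?E \<in> eff_divisors G 4"
    using ab a' b' by (simp add: eff_divisors_def)
  moreover have "?E - F = pt a' + pt b'"
    by (simp add: ab)
  moreover have "effective (pt a' + pt b')" by simp
  ultimately show ?thesis by metis
qed

context
  fixes x y :: real
  assumes n: "2 \<le> n"
    and q0: "q 0 = Inner (Seg 0) (l 0 / 2)"
    and q1: "q 1 = Inner (Seg 1) x" "0 < x" "x < l 1"
    and q2: "q 2 = Inner (Seg 2) y" "l 2 / 2 < y" "y < l 2"
begin

abbreviation (input) "mid j \<equiv> Inner (Loop j) (c j / 2) :: (vertex, edge) point"

lemma mid_in_points: "j \<le> n \<Longrightarrow> mid j \<in> points G"
  using c_pos[of j] by (simp add: points_G)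

text \<open>
  Rank 2 would allow removing the midpoints of the loops at \<open>q 0\<close> and \<open>q 2\<close>. Both loops must keep a
  chip, which leaves \<open>2 * q 1 \<sim> 2 * q 2\<close> on the theta graph.
\<close>

lemma rank_lt_2: "\<not> 2 \<le> div_rank G (pt (q 0) + pt (q 0) + pt (q 1) + pt (q 1))"
proof
  let ?D = "pt (q 0) + pt (q 0) + pt (q 1) + pt (q 1)"
  let ?F = "pt (mid 0) + pt (mid 2)"
  assume "2 \<le> div_rank G ?D"
  moreover have "?F \<in> eff_divisors G 2"
    using mid_in_points n by (auto simp: eff_divisors_2)
  ultimately obtain E where E: "divisor G E" "effective E" "lin_equiv G E (?D - ?F)"
    using div_rank_ge_iff[of 2 ?D] by (force simp: lin_sys_def)
  have lm: "weight (loop_moment j) (?D - ?F) / c j \<notin> \<int>" if "j = 0 \<or> j = 2" for j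
    using that n c_pos[of j] fraction_notin_Ints[of "- (c j / 2)" "c j"] by auto
  obtain u where u: "Inner (Loop 0) u \<in> Poly_Mapping.keys E"
    using chip_on_loop[OF E(3) _ lm[of 0]] n by auto
  obtain v where v: "Inner (Loop 2) v \<in> Poly_Mapping.keys E"
    using chip_on_loop[OF E(3) _ lm[of 2]] n by auto
  have "E \<in> eff_divisors G 2"
    using E lin_equiv_imp_invariants(2)[OF E(3)] by (simp add: eff_divisors_def)
  from two_points_in_degree_2[OF this u v]
  have E_eq: "E = pt (Inner (Loop 0) u) + pt (Inner (Loop 2) v)"
    by simp
  have "q 1 \<in> points G" using q1 by (simp add: points_G)
  moreover have "period l (\<lambda>i. theta_moment i (q 1) + theta_moment i (q 1) - 2 * theta_moment i (q 2))"
    by (rule period_shift[OF period_minus[OF lin_equiv_imp_invariants(3)[OF E(3)]], where d = 0])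
      (use n in \<open>simp add: E_eq\<close>)
  ultimately show False
    using double_rigid[of "q 1" x y] q1 q2 by simp
qed

text \<open>
  The points \<open>l 1 - x\<close> on edge \<open>1\<close> and \<open>l 2 - y\<close> on edge \<open>2\<close> are the mirror images of \<open>q 1\<close> and
  \<open>q 2\<close>. The role of the first is to keep the equivalences on the theta graph rigid in each of the
  three cases for \<open>T\<close>: it is paired with \<open>T\<close>, with the mirror image of \<open>q 2\<close>, or cancels one of the
  two chips at \<open>q 1\<close> against \<open>K\<close>.
\<close>

lemma no_rank_1_above:
  assumes T: "T \<in> points G"
  shows "\<not> 1 \<le> div_rank G (pt (mid 0) + pt (mid 1) + pt (Inner (Seg 1) (l 1 - x)) + pt T)"
proof
  let ?x' = "Inner (Seg 1) (l 1 - x)"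
  let ?D = "pt (mid 0) + pt (mid 1) + pt ?x' + pt T"
  assume rank: "1 \<le> div_rank G ?D"
  have c: "0 < c 0" "0 < c 1" "0 < c 2" and le: "0 \<le> n" "1 \<le> n" "2 \<le> n"
    using c_pos n by auto
  have lm_T: "loop_moment j T = 0 \<or> (\<exists>t. T = Inner (Loop j) t \<and> loop_moment j T = t \<and> 0 < t \<and> t < c j)" for j
    using T by (auto simp: loop_moment_def points_G split: point.splits edge.splits)
  \<comment> \<open>Any point inside the loop except \<open>T\<close> will do.\<close>
  define u where "u = (if T = mid 2 then c 2 / 3 else c 2 / 2)"
  have u: "0 < u" "u < c 2" "T \<noteq> Inner (Loop 2) u"
    using c by (auto simp: u_def)
  let ?Q = "Inner (Loop 2) u"
  have Q: "?Q \<in> points G" using u n by (simp add: points_G)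
  then obtain E where E: "divisor G E" "effective E" "lin_equiv G E (?D - pt ?Q)"
    using rank div_rank_ge_iff[of 1 ?D] by (force simp: lin_sys_def eff_divisors_1)
  have E3: "E \<in> eff_divisors G 3"
    using E lin_equiv_imp_invariants(2)[OF E(3)] by (simp add: eff_divisors_def)
  note per = lin_equiv_imp_invariants(3)[OF E(3)]
  have "loop_moment 2 T - u \<noteq> 0" "\<bar>loop_moment 2 T - u\<bar> < c 2"
    using lm_T[of 2] u by auto
  moreover have "weight (loop_moment 2) (?D - pt ?Q) = loop_moment 2 T - u"
    by simp
  ultimately have "weight (loop_moment 2) (?D - pt ?Q) / c 2 \<notin> \<int>"
    by (metis fraction_notin_Ints)
  then obtain w2 where w2: "Inner (Loop 2) w2 \<in> Poly_Mapping.keys E"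
    using chip_on_loop[OF E(3) le(3)] by blast
  have lm01: "weight (loop_moment j) (?D - pt ?Q) / c j \<notin> \<int>" if j: "j = 0 \<or> j = 1" and ne: "T \<noteq> mid j" for j
  proof -
    have cj: "0 < c j" using j c by auto
    \<comment> \<open>The moment lies in \<open>[c j / 2, 3 * c j / 2)\<close>, where the only multiple of \<open>c j\<close> is \<open>c j\<close> itself,\<close>
    \<comment> \<open>attained for \<open>T = mid j\<close>.\<close>
    have w: "weight (loop_moment j) (?D - pt ?Q) = c j / 2 + loop_moment j T"
      using j by auto
    have "(c j / 2 + loop_moment j T - c j) / c j \<notin> \<int> \<or> (c j / 2 + loop_moment j T) / c j \<notin> \<int>"
    proof (cases "loop_moment j T = 0")
      case True
      then show ?thesis
        using fraction_notin_Ints[of "c j / 2" "c j"] cj by simp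
    next
      case False
      then obtain t where t: "T = Inner (Loop j) t" "loop_moment j T = t" "0 < t" "t < c j"
        using lm_T[of j] by blast
      moreover have "t \<noteq> c j / 2" using ne t(1) by blast
      ultimately have "c j / 2 + loop_moment j T - c j \<noteq> 0" "\<bar>c j / 2 + loop_moment j T - c j\<bar> < c j"
        by auto
      then show ?thesis using fraction_notin_Ints by blast
    qed
    moreover have "(c j / 2 + loop_moment j T - c j) / c j = (c j / 2 + loop_moment j T) / c j - 1"
      using cj by (simp add: field_simps)
    ultimately show ?thesis
      unfolding w using Ints_diff[OF _ Ints_1] by metis
  qed
  consider "T = mid 0" | "T = mid 1" | "T \<noteq> mid 0" "T \<noteq> mid 1" by blast
  then show False
  proof cases
    case 1
    then have "T \<noteq> mid 1" by simp
    then obtain w1 where w1: "Inner (Loop 1) w1 \<in> Poly_Mapping.keys E"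
      using chip_on_loop[OF E(3) le(2)] lm01[of 1] by blast
    obtain z where z: "z \<in> points G" "E = pt (Inner (Loop 2) w2) + pt (Inner (Loop 1) w1) + pt z"
      by (rule two_points_in_degree_3[OF E3 w2 w1]) simp
    have "period l (\<lambda>i. theta_moment i z + theta_moment i (Inner (Seg 2) y) - (theta_moment i ?x' + theta_moment i (Inner (Seg 2) (l 2 - y))))"
      by (rule period_shift[OF period_add[OF per period_edge_lengths[of 0 2]], where d = 0])
        (use n q0 q1 q2 1 in \<open>auto simp: z\<close>)
    then show False
      using pair_rigid[OF z(1), of "l 1 - x" y "l 2 - y"] q1 q2 by auto
  next
    case 2
    then have "T \<noteq> mid 0" by simp
    then obtain w0 where w0: "Inner (Loop 0) w0 \<in> Poly_Mapping.keys E"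
      using chip_on_loop[OF E(3) le(1)] lm01[of 0] by blast
    obtain z where z: "z \<in> points G" "E = pt (Inner (Loop 2) w2) + pt (Inner (Loop 0) w0) + pt z"
      by (rule two_points_in_degree_3[OF E3 w2 w0]) simp
    have "period l (\<lambda>i. theta_moment i z + theta_moment i (Inner (Seg 2) y)
        - (theta_moment i (Inner (Seg 1) x) + theta_moment i (Inner (Seg 2) (l 2 - y))))"
      by (rule period_shift[OF period_add[OF per period_edge_lengths[of 1 2]], where d = 0])
        (use n q0 q1 q2 2 in \<open>auto simp: z\<close>)
    then show False
      using pair_rigid[OF z(1), of x y "l 2 - y"] q1 q2 by auto
  next
    case 3
    obtain w0 where w0: "Inner (Loop 0) w0 \<in> Poly_Mapping.keys E"
      using chip_on_loop[OF E(3) le(1)] lm01[of 0] 3 by blast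
    obtain w1 where w1: "Inner (Loop 1) w1 \<in> Poly_Mapping.keys E"
      using chip_on_loop[OF E(3) le(2)] lm01[of 1] 3 by blast
    obtain z where z: "E = pt (Inner (Loop 2) w2) + pt (Inner (Loop 0) w0) + pt z"
      and w1_z: "Inner (Loop 1) w1 = z"
      using w1 by (rule_tac two_points_in_degree_3[OF E3 w2 w0]) auto
    have "E = pt (Inner (Loop 2) w2) + pt (Inner (Loop 0) w0) + pt (Inner (Loop 1) w1)"
      unfolding z w1_z ..
    then have "period l (\<lambda>i. theta_moment i T + theta_moment i ?x' - 2 * theta_moment i (Inner (Seg 2) y))"
      by (intro period_shift[OF period_minus[OF per], where d = 0])
        (use n q0 q1 q2 in \<open>auto\<close>)
    then show False
      using double_rigid[OF T, of "l 1 - x" y] q1 q2 by simp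
  qed
qed

lemma wrd_eq_1: "wrd G 1 4 = 1"
proof -
  let ?W = "\<lambda>w. \<forall>F\<in>eff_divisors G (int (1 + w)).
       \<exists>E\<in>eff_divisors G (int 4). div_rank G E \<ge> int 1 \<and> effective (E - F)"
  have "has_grd G 1 4"
  proof -
    let ?D = "pt (q 0) + pt (q 0) + pt (q 1) + pt (q 1)"
    have q: "q 0 \<in> points G" "q 1 \<in> points G"
      using q0 q1 l_pos[of 0] by (simp_all add: points_G)
    obtain i j where on: "on_seg i (q 0)" "on_seg j (q 1)"
      using on_seg_q n by (metis le0 one_le_numeral order_trans)
    have "1 \<le> div_rank G ?D"
      by (rule rank_ge_1[OF lin_equiv_refl on(1,1,2,2)])
    with rank_lt_2 q show ?thesis
      unfolding has_grd_def by (intro exI[of _ ?D]) auto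
  qed
  moreover have "Greatest ?W = 1"
  proof (rule Greatest_equality)
    show "?W 1" using rank_1_divisor_through_two_points by simp
    fix w assume W: "?W w"
    show "w \<le> 1"
    proof (rule ccontr)
      assume "\<not> w \<le> 1"
      let ?F = "pt (mid 0) + pt (mid 1) + pt (Inner (Seg 1) (l 1 - x))"
      \<comment> \<open>Chips at \<open>V1\<close> fill up \<open>?F\<close> to the degree \<open>1 + w\<close>.\<close>
      let ?S = "Poly_Mapping.single (Vertex V1) (int (w - 2))"
      have pts: "mid 0 \<in> points G" "mid 1 \<in> points G" "Inner (Seg 1) (l 1 - x) \<in> points G"
        using mid_in_points n q1 by (auto simp: points_G)
      then have "?F + ?S \<in> eff_divisors G (int (1 + w))"
        using \<open>\<not> w \<le> 1\<close> by (simp add: eff_divisors_def)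
      then obtain E where E: "E \<in> eff_divisors G 4" "1 \<le> div_rank G E" "effective (E - (?F + ?S))"
        using W by fastforce
      have "effective (E - ?F)"
        using effective_simps(1)[OF E(3), of ?S] by simp
      then have "E - ?F \<in> eff_divisors G 1"
        using E(1) pts by (simp add: eff_divisors_def)
      then obtain T where "T \<in> points G" "E - ?F = pt T"
        by (auto simp: eff_divisors_1)
      then show False
        using no_rank_1_above[of T] E(2) by (metis add.commute diff_add_cancel)
    qed
  qed
  ultimately show ?thesis
    by (simp add: wrd_def)
qed

end

end

theorem proposition2:
  fixes n :: nat and l c :: "nat \<Rightarrow> real" and q :: "nat \<Rightarrow> (vertex, edge) point"
  assumes "n \<ge> 2"
    and "\<And>i. i \<le> 2 \<Longrightarrow> 0 < l i"
    and "l 0 \<noteq> l 1" and "l 0 \<noteq> l 2" and "l 1 \<noteq> l 2"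
    and "q 0 = theta_mid l 0"
    and "q 1 \<in> edge_map (theta l) (Seg 1) ` {0<..<l 1 / 2}"
    and "q 2 \<in> edge_map (theta l) (Seg 2) ` {l 2 / 2<..<l 2}"
    and "\<And>i. 3 \<le> i \<Longrightarrow> i \<le> n \<Longrightarrow> q i \<in> points (theta l)"
    and "distinct ([Vertex V1, Vertex V2, theta_mid l 0, theta_mid l 1, theta_mid l 2]
           @ map q [1..<Suc n])"
    and "\<And>i. i \<le> n \<Longrightarrow> 0 < c i"
  shows "wrd (theta_loops l q c n) 1 4 = 1"
proof -
  have l: "0 < l 0" "0 < l 1" "0 < l 2" using assms(2) by auto
  have q0: "q 0 = Inner (Seg 0) (l 0 / 2)"
    using assms(6) l by (auto simp: theta_mid_def edge_map_def theta_def)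
  obtain x where x: "q 1 = Inner (Seg 1) x" "0 < x" "x < l 1 / 2"
    using assms(7) l by (auto simp: edge_map_def theta_def)
  obtain y where y: "q 2 = Inner (Seg 2) y" "l 2 / 2 < y" "y < l 2"
    using assms(8) l by (auto simp: edge_map_def theta_def)
  interpret theta_with_loops n l c q
  proof
    fix j assume j: "j \<le> n"
    consider "j = 0" | "j = 1" | "j = 2" | "3 \<le> j" by linarith
    then show "\<exists>i u. i \<le> 2 \<and> 0 < u \<and> u < l i \<and> q j = Inner (Seg i) u"
    proof cases
      case 1
      then show ?thesis using q0 l by (intro exI[of _ 0] exI[of _ "l 0 / 2"]) auto
    next
      case 2
      then show ?thesis using x l by (intro exI[of _ 1] exI[of _ x]) auto
    next
      case 3
      then show ?thesis using y l by (intro exI[of _ 2] exI[of _ y]) auto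
    next
      case 4
      then have "q j \<in> q ` {1..<Suc n}" using j by auto
      then have "q j \<noteq> Vertex V1" "q j \<noteq> Vertex V2"
        using assms(10) by (auto simp del: upt_Suc)
      with assms(9)[OF 4 j] show ?thesis
        by (auto simp: points_def theta_def intro: le_SucI)
    qed
  qed (use assms in auto)
  show ?thesis
    using wrd_eq_1[OF assms(1) q0 x(1) x(2) _ y] x l by simp
qed

end
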